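(* Let $\Phi:\mathcal{L}(\mathcal{H})\to\mathcal{L}(\mathcal{K})$ be a quantum channel with $d=\dim\mathcal{H}$, and let $p(r)$ denote the number of integer partitions of $r$. Then, for every $n\geq1$, $$w_n(\Phi)\leq\sum_{r=1}^{d^n}p(r)\leq2^{d^n}-1.$$ Moreover, $$w_n(\Phi)\leq\frac{1+o(1)}{4\sqrt3}\exp\left(\pi\sqrt{\frac{2d^n}{3}}\right),\qquad n\to\infty.$$ In particular, the growth of $w_n(\Phi)$ is at most double exponential in $n$.
   Context: All Hilbert spaces are finite-dimensional and complex; all $C^*$-algebras are finite-dimensional and nonzero. $\mathcal{L}(\mathcal{H})$ is the algebra of linear operators on $\mathcal{H}$. A quantum channel is a linear, completely positive, trace-preserving map $\Phi:\mathcal{L}(\mathcal{H})\to\mathcal{L}(\mathcal{K})$; its adjoint $\Phi^*$ is defined by $\mathrm{Tr}(Y\Phi(X))=\mathrm{Tr}(\Phi^*(Y)X)$. In the asymptotic statement $\Phi$ is fixed and $n\to\infty$. Embedding: $\mathscr{A}\leq\mathscr{B}$ means there is an injective (not necessarily unital) $*$-homomorphism $\mathscr{A}\to\mathscr{B}$. Correctability: a $*$-subalgebra $\mathscr{A}\subseteq\mathcal{L}(\mathcal{H})$ with unit projection $P$ (possibly $P\neq 1_{\mathcal{H}}$) is correctable for $\Phi$ if, with $C=P\mathcal{H}$, $V:C\to\mathcal{H}$ the inclusion and $\Phi|_C(Y)=\Phi(VYV^* )$, there is a channel $\mathcal{D}:\mathcal{L}(\mathcal{K})\to\mathcal{L}(C)$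 with $(\mathcal{D}\circ\Phi|_C)^*(X)=X$ for all $X\in V^*\mathscr{A}V$. $\mathscr{A}$ is transmittable via $\Phi$ if there is an injective $*$-homomorphism $\pi:\mathscr{A}\to\mathcal{L}(\mathcal{H})$ whose image is correctable for $\Phi$; $\mathscr{T}(\Phi)$ is the set of transmittable algebras up to $*$-isomorphism. $\max(\mathscr{T}(\Phi))$ is the set of those $\mathscr{A}\in\mathscr{T}(\Phi)$ such that $\mathscr{B}\in\mathscr{T}(\Phi)$, $\mathscr{A}\leq\mathscr{B}$ imply $\mathscr{A}\cong\mathscr{B}$, counted up to $*$-isomorphism. Width: $w_n(\Phi)=|\max(\mathscr{T}(\Phi^{\otimes n}))|$. *)

theory Defs
  imports
    "Jordan_Normal_Form.VS_Connect"
    "Jordan_Normal_Form.Schur_Decomposition"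
begin

text \<open>
  A Hilbert space of dimension \<open>d\<close> is taken in coordinates as \<open>\<complex>\<^sup>d\<close>, so that the operators on it
  are \<^term>\<open>carrier_mat d d :: complex mat set\<close>. A map between operator algebras is a function on
  \<^typ>\<open>complex mat\<close>; only its values on the relevant carrier matter.
\<close>

definition mat_trace :: "complex mat \<Rightarrow> complex" where
  "mat_trace A = (\<Sum>i<dim_row A. A $$ (i, i))"

text \<open>With the order of \<^theory>\<open>HOL-Library.Complex_Order\<close>, \<open>0 \<le> z\<close> says that \<open>z\<close> is real and nonnegative.\<close>

definition mat_psd :: "nat \<Rightarrow> complex mat \<Rightarrow> bool" where
  "mat_psd d A \<longleftrightarrow> A \<in> carrier_mat d d \<and> (\<forall>v \<in> carrier_vec d. 0 \<le> (A *\<^sub>v v) \<bullet>c v)"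

definition mat_unit :: "nat \<Rightarrow> nat \<Rightarrow> nat \<Rightarrow> complex mat" where
  "mat_unit d i j = mat d d (\<lambda>(r, s). if r = i \<and> s = j then 1 else 0)"

definition kron :: "complex mat \<Rightarrow> complex mat \<Rightarrow> complex mat" where
  "kron A B = mat (dim_row A * dim_row B) (dim_col A * dim_col B)
     (\<lambda>(i, j). A $$ (i div dim_row B, j div dim_col B) * B $$ (i mod dim_row B, j mod dim_col B))"

text \<open>
  The tensor product of linear maps \<open>\<Phi> : M\<^sub>a \<rightarrow> M\<^sub>b\<close> and \<open>\<Psi> : M\<^sub>c \<rightarrow> M\<^sub>e\<close>, i.e. the linear map
  \<open>M\<^sub>a\<^sub>c \<rightarrow> M\<^sub>b\<^sub>e\<close> with \<open>kron X Y \<mapsto> kron (\<Phi> X) (\<Psi> Y)\<close>. It is obtained by expanding the argument in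
  the basis \<open>kron E\<^sub>i\<^sub>j E\<^sub>p\<^sub>q\<close>, whose coefficients are the entries at \<open>(i c + p, j c + q)\<close>.
\<close>

definition tensor_map :: "nat \<Rightarrow> nat \<Rightarrow> nat \<Rightarrow> nat \<Rightarrow> (complex mat \<Rightarrow> complex mat) \<Rightarrow>
    (complex mat \<Rightarrow> complex mat) \<Rightarrow> complex mat \<Rightarrow> complex mat" where
  "tensor_map a b c e \<Phi> \<Psi> X = mat (b * e) (b * e) (\<lambda>(r, s).
     \<Sum>i<a. \<Sum>j<a. \<Sum>p<c. \<Sum>q<c.
       X $$ (i * c + p, j * c + q) * kron (\<Phi> (mat_unit a i j)) (\<Psi> (mat_unit c p q)) $$ (r, s))"

primrec tensor_power :: "nat \<Rightarrow> nat \<Rightarrow> (complex mat \<Rightarrow> complex mat) \<Rightarrow> nat \<Rightarrow>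
    complex mat \<Rightarrow> complex mat" where
  "tensor_power d k \<Phi> 0 = (\<lambda>X. X)"
| "tensor_power d k \<Phi> (Suc n) = tensor_map d k (d ^ n) (k ^ n) \<Phi> (tensor_power d k \<Phi> n)"

definition quantum_channel :: "nat \<Rightarrow> nat \<Rightarrow> (complex mat \<Rightarrow> complex mat) \<Rightarrow> bool" where
  "quantum_channel d k \<Phi> \<longleftrightarrow>
     (\<forall>X \<in> carrier_mat d d. \<Phi> X \<in> carrier_mat k k) \<and>
     (\<forall>X \<in> carrier_mat d d. \<forall>Y \<in> carrier_mat d d. \<Phi> (X + Y) = \<Phi> X + \<Phi> Y) \<and>
     (\<forall>c. \<forall>X \<in> carrier_mat d d. \<Phi> (c \<cdot>\<^sub>m X) = c \<cdot>\<^sub>m \<Phi> X) \<and>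
     (\<forall>m X. mat_psd (m * d) X \<longrightarrow> mat_psd (m * k) (tensor_map m m d k (\<lambda>Y. Y) \<Phi> X)) \<and>
     (\<forall>X \<in> carrier_mat d d. mat_trace (\<Phi> X) = mat_trace X)"

definition dual_map :: "nat \<Rightarrow> (complex mat \<Rightarrow> complex mat) \<Rightarrow> complex mat \<Rightarrow> complex mat" where
  "dual_map d \<Phi> Y = (THE Z. Z \<in> carrier_mat d d \<and>
     (\<forall>X \<in> carrier_mat d d. mat_trace (Y * \<Phi> X) = mat_trace (Z * X)))"


text \<open>
  A \<open>*\<close>-algebra extends the \<open>module\<close> record of \<^theory>\<open>HOL-Algebra.Module\<close>, scalars being the
  complex numbers. That record contains a field \<open>one\<close>; no condition below refers to it, so that
  neither algebras nor homomorphisms are assumed unital.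
\<close>

record 'a star_algebra = "(complex, 'a) module" +
  star :: "'a \<Rightarrow> 'a"

definition cstar_norm :: "('a, 'm) star_algebra_scheme \<Rightarrow> ('a \<Rightarrow> real) \<Rightarrow> bool" where
  "cstar_norm A N \<longleftrightarrow>
     (\<forall>x \<in> carrier A. 0 \<le> N x \<and> (N x = 0 \<longleftrightarrow> x = \<zero>\<^bsub>A\<^esub>)) \<and>
     (\<forall>a. \<forall>x \<in> carrier A. N (a \<odot>\<^bsub>A\<^esub> x) = cmod a * N x) \<and>
     (\<forall>x \<in> carrier A. \<forall>y \<in> carrier A. N (x \<oplus>\<^bsub>A\<^esub> y) \<le> N x + N y) \<and>
     (\<forall>x \<in> carrier A. \<forall>y \<in> carrier A. N (x \<otimes>\<^bsub>A\<^esub> y) \<le> N x * N y) \<and>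
     (\<forall>x \<in> carrier A. N (star A x \<otimes>\<^bsub>A\<^esub> x) = (N x)\<^sup>2) \<and>
     (\<forall>u. (\<forall>i. u i \<in> carrier A) \<and>
          (\<forall>e>0. \<exists>M. \<forall>i\<ge>M. \<forall>j\<ge>M. N (u i \<ominus>\<^bsub>A\<^esub> u j) < e) \<longrightarrow>
          (\<exists>x \<in> carrier A. (\<lambda>i::nat. N (u i \<ominus>\<^bsub>A\<^esub> x)) \<longlonglongrightarrow> 0))"

locale fd_cstar_algebra = vectorspace class_ring A
  for A :: "('a, 'm) star_algebra_scheme" +
  assumes mult_closed: "x \<in> carrier A \<Longrightarrow> y \<in> carrier A \<Longrightarrow> x \<otimes>\<^bsub>A\<^esub> y \<in> carrier A"
    and mult_assoc: "x \<in> carrier A \<Longrightarrow> y \<in> carrier A \<Longrightarrow> z \<in> carrier A \<Longrightarrow>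
      (x \<otimes>\<^bsub>A\<^esub> y) \<otimes>\<^bsub>A\<^esub> z = x \<otimes>\<^bsub>A\<^esub> (y \<otimes>\<^bsub>A\<^esub> z)"
    and mult_l_distr: "x \<in> carrier A \<Longrightarrow> y \<in> carrier A \<Longrightarrow> z \<in> carrier A \<Longrightarrow>
      (x \<oplus>\<^bsub>A\<^esub> y) \<otimes>\<^bsub>A\<^esub> z = x \<otimes>\<^bsub>A\<^esub> z \<oplus>\<^bsub>A\<^esub> y \<otimes>\<^bsub>A\<^esub> z"
    and mult_r_distr: "x \<in> carrier A \<Longrightarrow> y \<in> carrier A \<Longrightarrow> z \<in> carrier A \<Longrightarrow>
      x \<otimes>\<^bsub>A\<^esub> (y \<oplus>\<^bsub>A\<^esub> z) = x \<otimes>\<^bsub>A\<^esub> y \<oplus>\<^bsub>A\<^esub> x \<otimes>\<^bsub>A\<^esub> z"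
    and mult_smult_l: "x \<in> carrier A \<Longrightarrow> y \<in> carrier A \<Longrightarrow>
      (a \<odot>\<^bsub>A\<^esub> x) \<otimes>\<^bsub>A\<^esub> y = a \<odot>\<^bsub>A\<^esub> (x \<otimes>\<^bsub>A\<^esub> y)"
    and mult_smult_r: "x \<in> carrier A \<Longrightarrow> y \<in> carrier A \<Longrightarrow>
      x \<otimes>\<^bsub>A\<^esub> (a \<odot>\<^bsub>A\<^esub> y) = a \<odot>\<^bsub>A\<^esub> (x \<otimes>\<^bsub>A\<^esub> y)"
    and star_closed: "x \<in> carrier A \<Longrightarrow> star A x \<in> carrier A"
    and star_star: "x \<in> carrier A \<Longrightarrow> star A (star A x) = x"
    and star_add: "x \<in> carrier A \<Longrightarrow> y \<in> carrier A \<Longrightarrow>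
      star A (x \<oplus>\<^bsub>A\<^esub> y) = star A x \<oplus>\<^bsub>A\<^esub> star A y"
    and star_smult: "x \<in> carrier A \<Longrightarrow> star A (a \<odot>\<^bsub>A\<^esub> x) = cnj a \<odot>\<^bsub>A\<^esub> star A x"
    and star_mult: "x \<in> carrier A \<Longrightarrow> y \<in> carrier A \<Longrightarrow>
      star A (x \<otimes>\<^bsub>A\<^esub> y) = star A y \<otimes>\<^bsub>A\<^esub> star A x"
    and ex_cstar_norm: "\<exists>N. cstar_norm A N"
    and finite_dimensional: "fin_dim"
    and nonzero: "carrier A \<noteq> {\<zero>\<^bsub>A\<^esub>}"

definition star_hom ::
  "('a, 'm) star_algebra_scheme \<Rightarrow> ('b, 'n) star_algebra_scheme \<Rightarrow> ('a \<Rightarrow> 'b) \<Rightarrow> bool" where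
  "star_hom A B \<pi> \<longleftrightarrow>
     (\<forall>x \<in> carrier A. \<pi> x \<in> carrier B) \<and>
     (\<forall>x \<in> carrier A. \<forall>y \<in> carrier A. \<pi> (x \<oplus>\<^bsub>A\<^esub> y) = \<pi> x \<oplus>\<^bsub>B\<^esub> \<pi> y) \<and>
     (\<forall>a. \<forall>x \<in> carrier A. \<pi> (a \<odot>\<^bsub>A\<^esub> x) = a \<odot>\<^bsub>B\<^esub> \<pi> x) \<and>
     (\<forall>x \<in> carrier A. \<forall>y \<in> carrier A. \<pi> (x \<otimes>\<^bsub>A\<^esub> y) = \<pi> x \<otimes>\<^bsub>B\<^esub> \<pi> y) \<and>
     (\<forall>x \<in> carrier A. \<pi> (star A x) = star B (\<pi> x))"

definition star_embeds ::
  "('a, 'm) star_algebra_scheme \<Rightarrow> ('b, 'n) star_algebra_scheme \<Rightarrow> bool" where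
  "star_embeds A B \<longleftrightarrow> (\<exists>\<pi>. star_hom A B \<pi> \<and> inj_on \<pi> (carrier A))"

definition star_isomorphic ::
  "('a, 'm) star_algebra_scheme \<Rightarrow> ('b, 'n) star_algebra_scheme \<Rightarrow> bool" where
  "star_isomorphic A B \<longleftrightarrow> (\<exists>\<pi>. star_hom A B \<pi> \<and> bij_betw \<pi> (carrier A) (carrier B))"

definition mat_star_algebra :: "nat \<Rightarrow> complex mat star_algebra" where
  "mat_star_algebra d = \<lparr>carrier = carrier_mat d d, monoid.mult = (*), one = 1\<^sub>m d, zero = 0\<^sub>m d d,
     add = (+), module.smult = (\<cdot>\<^sub>m), star = mat_adjoint\<rparr>"

definition star_subalgebra :: "'a set \<Rightarrow> ('a, 'm) star_algebra_scheme \<Rightarrow> bool" where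
  "star_subalgebra S A \<longleftrightarrow>
     S \<subseteq> carrier A \<and> \<zero>\<^bsub>A\<^esub> \<in> S \<and>
     (\<forall>x \<in> S. \<forall>y \<in> S. x \<oplus>\<^bsub>A\<^esub> y \<in> S) \<and>
     (\<forall>a. \<forall>x \<in> S. a \<odot>\<^bsub>A\<^esub> x \<in> S) \<and>
     (\<forall>x \<in> S. \<forall>y \<in> S. x \<otimes>\<^bsub>A\<^esub> y \<in> S) \<and>
     (\<forall>x \<in> S. star A x \<in> S)"


text \<open>
  \<open>P\<close> is the unit projection of \<open>S\<close>, and the columns of \<open>V\<close> are an orthonormal basis of the
  subspace \<open>C = P \<complex>\<^sup>d\<close> of dimension \<open>c\<close>; identifying \<open>C\<close> with \<open>\<complex>\<^sup>c\<close> by this basis, \<open>V\<close> is the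
  inclusion of \<open>C\<close>. Such a \<open>V\<close> exists for every projection \<open>P\<close>, and replacing \<open>V\<close> by another
  choice \<open>V U\<close> with \<open>U\<close> unitary amounts to conjugating the decoder \<open>D\<close> by \<open>U\<close>.
\<close>

definition correctable :: "nat \<Rightarrow> nat \<Rightarrow> (complex mat \<Rightarrow> complex mat) \<Rightarrow> complex mat set \<Rightarrow> bool" where
  "correctable d k \<Phi> S \<longleftrightarrow>
     star_subalgebra S (mat_star_algebra d) \<and> S \<noteq> {0\<^sub>m d d} \<and>
     (\<exists>P c V D.
        P \<in> S \<and> (\<forall>X \<in> S. P * X = X \<and> X * P = X) \<and>
        V \<in> carrier_mat d c \<and> mat_adjoint V * V = 1\<^sub>m c \<and> V * mat_adjoint V = P \<and>
        quantum_channel k c D \<and>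
        (\<forall>X \<in> (\<lambda>Z. mat_adjoint V * Z * V) ` S.
           dual_map c (D \<circ> (\<lambda>Y. \<Phi> (V * Y * mat_adjoint V))) X = X))"

definition transmittable ::
  "nat \<Rightarrow> nat \<Rightarrow> (complex mat \<Rightarrow> complex mat) \<Rightarrow> ('a, 'm) star_algebra_scheme \<Rightarrow> bool" where
  "transmittable d k \<Phi> A \<longleftrightarrow> fd_cstar_algebra A \<and>
     (\<exists>\<pi>. star_hom A (mat_star_algebra d) \<pi> \<and> inj_on \<pi> (carrier A) \<and>
          correctable d k \<Phi> (\<pi> ` carrier A))"

text \<open>
  To collect the transmittable algebras in a set, their elements are taken from \<^typ>\<open>complex mat\<close>.
  Up to \<open>*\<close>-isomorphism this is no restriction: an algebra that is transmittable by way of \<open>\<pi>\<close> is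
  \<open>*\<close>-isomorphic to the image of \<open>\<pi>\<close>.
\<close>

definition transmittable_algebras ::
  "nat \<Rightarrow> nat \<Rightarrow> (complex mat \<Rightarrow> complex mat) \<Rightarrow> complex mat star_algebra set" where
  "transmittable_algebras d k \<Phi> = {A. transmittable d k \<Phi> A}"

definition max_transmittable ::
  "nat \<Rightarrow> nat \<Rightarrow> (complex mat \<Rightarrow> complex mat) \<Rightarrow> complex mat star_algebra set" where
  "max_transmittable d k \<Phi> = {A \<in> transmittable_algebras d k \<Phi>.
     \<forall>B \<in> transmittable_algebras d k \<Phi>. star_embeds A B \<longrightarrow> star_isomorphic A B}"

definition max_transmittable_classes ::
  "nat \<Rightarrow> nat \<Rightarrow> (complex mat \<Rightarrow> complex mat) \<Rightarrow> complex mat star_algebra set set" where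
  "max_transmittable_classes d k \<Phi> = max_transmittable d k \<Phi> //
     {(A, B). A \<in> max_transmittable d k \<Phi> \<and> B \<in> max_transmittable d k \<Phi> \<and> star_isomorphic A B}"

definition width :: "nat \<Rightarrow> nat \<Rightarrow> (complex mat \<Rightarrow> complex mat) \<Rightarrow> nat \<Rightarrow> nat" where
  "width d k \<Phi> n = card (max_transmittable_classes (d ^ n) (k ^ n) (tensor_power d k \<Phi> n))"

definition num_partitions :: "nat \<Rightarrow> nat" where
  "num_partitions r = card {M :: nat multiset. 0 \<notin># M \<and> \<Sum>\<^sub># M = r}"

end

theory Submission
  imports "HOL-Analysis.Gamma_Function" Defs "Jordan_Normal_Form.Matrix_Kernel"
begin

text \<open>
  A transmittable algebra is \<open>*\<close>-isomorphic to a nonzero \<open>*\<close>-subalgebra \<open>S\<close> of \<open>M\<^sub>D\<close>, \<open>D = d\<^sup>n\<close>, that has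
  a unit. Such an \<open>S\<close> is a direct sum of full matrix algebras of sizes \<open>m\<^sub>1, \<dots>, m\<^sub>l\<close> with
  \<open>1 \<le> m\<^sub>1 + \<dots> + m\<^sub>l \<le> D\<close>, and these sizes determine it up to \<open>*\<close>-isomorphism, so that there are at
  most \<open>p(1) + \<dots> + p(D)\<close> classes. The sizes arise from a maximal family of mutually orthogonal
  minimal projections of \<open>S\<close>, where \<open>p\<close> and \<open>q\<close> belong to the same summand iff \<open>p S q \<noteq> 0\<close>.

  For the asymptotic bound, \<open>p(0) + \<dots> + p(D) \<le> x\<^sup>-\<^sup>D \<Prod>\<^sub>k 1 / (1 - x\<^sup>k)\<close> for \<open>0 < x < 1\<close>. With
  \<open>x = exp (-s)\<close> and \<open>s = \<pi> / \<surd>(6 D)\<close> the right-hand side is \<open>exp (\<pi> \<surd>(2 D / 3))\<close> times a factor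
  that tends to \<open>0\<close>.
\<close>

section \<open>Integer partitions\<close>

text \<open>The constant 1 / (4 sqrt 3) is not approached: p(0) + ... + p(D) is of smaller order
  than exp (pi sqrt (2 D / 3)), so every positive constant eventually suffices, and a factor tending
  to 0 has to be won over the leading exponential. The value of s minimises s D + pi^2 / (6 s),
  whose summands are then equal. The factor comes from 1 / (exp t - 1) falling short of 1 / t by at
  least 1/3 when t \<le> 1; over the terms m of Euler's logarithm with m s \<le> 1 this saves a
  third of a harmonic number, which is unbounded as s tends to 0. The dimension D = d^n tends to
  infinity only for d \<ge> 2, so d \<le> 1 is settled by the bound 2^D - 1. On the algebraic side,
  linked projections are joined by partial isometries that are unique only up to a phase, whereas
  matrix units must multiply exactly. Hence each class gets one representative through which all its
  units are routed. The operations on coefficients then depend on the equivalence relation alone,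
  and an equivalence relation on a finite set is determined up to relabelling by its class
  sizes.\<close>

lemma sum_mset_nat_eq_sum:
  fixes M :: "nat multiset"
  assumes "finite A" "set_mset M \<subseteq> A"
  shows "\<Sum>\<^sub># M = (\<Sum>k\<in>A. k * count M k)"
  using assms(2)
proof (induction M)
  case empty
  then show ?case by simp
next
  case (add x M)
  then have x: "x \<in> A" and IH: "\<Sum>\<^sub># M = (\<Sum>k\<in>A. k * count M k)"
    by auto
  have "(\<Sum>k\<in>A. k * count (add_mset x M) k) = (\<Sum>k\<in>A. k * count M k + (if k = x then k else 0))"
    by (intro sum.cong) auto
  also have "\<dots> = \<Sum>\<^sub># M + x"
    using x assms(1) by (simp add: sum.distrib IH)
  finally show ?case by simp
qed

text \<open>The empty partition is included, so the cardinality is p(0) + ... + p(N), the quantity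
  to which the generating function applies directly.\<close>

definition partitions_upto :: "nat \<Rightarrow> nat multiset set" where
  "partitions_upto N = {M. 0 \<notin># M \<and> \<Sum>\<^sub># M \<le> N}"

lemma partition_parts_subset:
  assumes "M \<in> partitions_upto N"
  shows "set_mset M \<subseteq> {1..N}"
proof
  fix x assume x: "x \<in># M"
  then have "x \<le> \<Sum>\<^sub># M"
    by (metis le_add1 multi_member_split sum_mset.add_mset)
  with x assms show "x \<in> {1..N}"
    unfolding partitions_upto_def by (cases x) auto
qed

lemma count_partition_le:
  assumes "M \<in> partitions_upto N"
  shows "count M k \<le> N"
proof (cases "k \<in># M")
  case True
  have k: "k \<in> {1..N}" using True partition_parts_subset[OF assms] by auto
  have "count M k \<le> k * count M k" using k by simp
  also have "\<dots> \<le> (\<Sum>k\<in>{1..N}. k * count M k)"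
    using k by (intro member_le_sum) auto
  also have "\<dots> = \<Sum>\<^sub># M"
    using sum_mset_nat_eq_sum[OF _ partition_parts_subset[OF assms]] by simp
  finally show ?thesis using assms unfolding partitions_upto_def by simp
qed (simp add: not_in_iff)

lemma multiplicities_mem_PiE:
  assumes "M \<in> partitions_upto N"
  shows "restrict (count M) {1..N} \<in> {1..N} \<rightarrow>\<^sub>E {..N}"
  using count_partition_le[OF assms] by auto

text \<open>All parts lie in \<open>{1..N}\<close>, so the multiplicities there determine the
  partition. This places the partitions inside a finite box of functions, which gives finiteness and
  later the product form of the generating function.\<close>

lemma inj_on_multiplicities:
  "inj_on (\<lambda>M. restrict (count M) {1..N}) (partitions_upto N)"
proof (rule inj_onI)
  fix M M' assume M: "M \<in> partitions_upto N" and M': "M' \<in> partitions_upto N"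
    and eq: "restrict (count M) {1..N} = restrict (count M') {1..N}"
  show "M = M'"
  proof (rule multiset_eqI)
    fix k
    show "count M k = count M' k"
    proof (cases "k \<in> {1..N}")
      case True
      then show ?thesis using fun_cong[OF eq, of k] by simp
    next
      case False
      then have "k \<notin># M" "k \<notin># M'"
        using partition_parts_subset[OF M] partition_parts_subset[OF M'] by auto
      then show ?thesis by (simp add: not_in_iff)
    qed
  qed
qed

lemma finite_partitions_upto: "finite (partitions_upto N)"
proof (rule inj_on_finite[OF inj_on_multiplicities])
  show "(\<lambda>M. restrict (count M) {1..N}) ` partitions_upto N \<subseteq> {1..N} \<rightarrow>\<^sub>E {..N}"
    using multiplicities_mem_PiE by blast
qed (auto intro: finite_PiE)

lemma finite_partitions: "finite {M :: nat multiset. 0 \<notin># M \<and> \<Sum>\<^sub># M = r}"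
  by (rule finite_subset[OF _ finite_partitions_upto[of r]]) (auto simp: partitions_upto_def)

lemma sum_num_partitions:
  "(\<Sum>r = 1..N. num_partitions r) = card {M :: nat multiset. 0 \<notin># M \<and> \<Sum>\<^sub># M \<in> {1..N}}"
proof -
  have "{M :: nat multiset. 0 \<notin># M \<and> \<Sum>\<^sub># M \<in> {1..N}} =
      (\<Union>r\<in>{1..N}. {M. 0 \<notin># M \<and> \<Sum>\<^sub># M = r})"
    by auto
  then show ?thesis
    unfolding num_partitions_def
    by (simp only:) (subst card_UN_disjoint; auto simp: finite_partitions)
qed

text \<open>A partition of \<open>n + 1\<close> either has a part \<open>1\<close>, which can be removed, or can have its smallest
  part lowered by one, which then becomes the unique smallest part.\<close>

lemma num_partitions_Suc_le:
  assumes "n \<ge> 1"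
  shows "num_partitions (Suc n) \<le> 2 * num_partitions n"
proof -
  let ?P = "\<lambda>r. {M :: nat multiset. 0 \<notin># M \<and> \<Sum>\<^sub># M = r}"
  let ?A = "{M \<in> ?P (Suc n). 1 \<in># M}" and ?B = "{M \<in> ?P (Suc n). 1 \<notin># M}"
  define lower where "lower M = add_mset (Min_mset M - 1) (M - {#Min_mset M#})" for M :: "nat multiset"
  have ge2: "Min_mset M \<ge> 2 \<and> Min_mset M \<in># M" if "M \<in> ?B" for M
  proof -
    have "M \<noteq> {#}" using that by auto
    then have mem: "Min_mset M \<in># M" by (simp add: Min_in)
    moreover have "Min_mset M \<noteq> 0" "Min_mset M \<noteq> 1"
      using mem that by (metis (mono_tags, lifting) mem_Collect_eq)+
    ultimately show ?thesis by linarith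
  qed
  have min_lower: "Min_mset (lower M) = Min_mset M - 1" if "M \<in> ?B" for M
    unfolding lower_def
    by (rule Min_eqI) (auto dest!: in_diffD intro: order.trans[OF diff_le_self Min_le[OF finite_set_mset]])
  have raise: "M = add_mset (Suc (Min_mset (lower M))) (lower M - {#Min_mset (lower M)#})"
    if "M \<in> ?B" for M
    using ge2[OF that] unfolding min_lower[OF that] by (simp add: lower_def)
  have "inj_on lower ?B"
    by (rule inj_onI) (metis (no_types, lifting) raise)
  moreover have "lower ` ?B \<subseteq> ?P n"
  proof
    fix L assume "L \<in> lower ` ?B"
    then obtain M where M: "M \<in> ?B" and L: "L = lower M" by blast
    define m where "m = Min_mset M"
    have m: "m \<ge> 2" "m \<in># M" using ge2[OF M] by (simp_all add: m_def)
    from m(2) obtain M' where M': "M = add_mset m M'" by (meson multi_member_split)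
    have "lower M = add_mset (m - 1) M'"
      unfolding lower_def m_def[symmetric] by (simp add: M')
    then show "L \<in> ?P n" using M m(1) unfolding L by (auto simp: M')
  qed
  ultimately have B: "card ?B \<le> num_partitions n"
    unfolding num_partitions_def using card_inj_on_le finite_partitions by blast
  have "inj_on (\<lambda>M. M - {#1#}) ?A"
    by (rule inj_onI) (metis (no_types, lifting) insert_DiffM mem_Collect_eq)
  moreover have "(\<lambda>M. M - {#1#}) ` ?A \<subseteq> ?P n"
    by (auto dest: in_diffD simp: sum_mset.remove)
  ultimately have A: "card ?A \<le> num_partitions n"
    unfolding num_partitions_def using card_inj_on_le finite_partitions by blast
  have "num_partitions (Suc n) = card (?A \<union> ?B)"
    unfolding num_partitions_def by (rule arg_cong[where f = card]) auto
  also have "\<dots> \<le> card ?A + card ?B" by (rule card_Un_le)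
  finally show ?thesis using A B by simp
qed

text \<open>Doubling starts at p(1) = 1 instead of p(0) = 1. This gains the factor two that turns
  the sum of the bounds into exactly \<open>2 ^ N - 1\<close>.\<close>

lemma num_partitions_le_power: "num_partitions (Suc n) \<le> 2 ^ n"
proof (induction n)
  case 0
  have "M = {#1#}" if "0 \<notin># M" "\<Sum>\<^sub># M = Suc 0" for M :: "nat multiset"
  proof -
    have "M \<noteq> {#}" using that(2) by auto
    then obtain x M' where M: "M = add_mset x M'" by (metis multiset_cases)
    with that have "x \<noteq> 0" "x + \<Sum>\<^sub># M' = 1" "0 \<notin># M'" by simp_all
    then have "x = 1" "\<Sum>\<^sub># M' = 0" "0 \<notin># M'" by linarith+
    moreover then have "M' = {#}" by (cases M') auto
    ultimately show ?thesis using M by simp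
  qed
  then have "{M :: nat multiset. 0 \<notin># M \<and> \<Sum>\<^sub># M = Suc 0} \<subseteq> {{#1#}}" by blast
  then have "card {M :: nat multiset. 0 \<notin># M \<and> \<Sum>\<^sub># M = Suc 0} \<le> card {{#1::nat#}}"
    by (rule card_mono[rotated]) simp
  then show ?case unfolding num_partitions_def by simp
next
  case (Suc n)
  then show ?case using num_partitions_Suc_le[of "Suc n"] by simp
qed

lemma sum_num_partitions_le_power: "(\<Sum>r = 1..N. num_partitions r) \<le> 2 ^ N - 1"
proof (induction N)
  case (Suc N)
  have "(\<Sum>r = 1..Suc N. num_partitions r) \<le> (2 ^ N - 1) + 2 ^ N"
    using Suc num_partitions_le_power[of N] by simp
  also have "\<dots> = 2 ^ Suc N - 1" by simp
  finally show ?case .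
qed simp

section \<open>The generating function of partitions and its estimate\<close>

text \<open>A truncated Euler product: the weight of a partition factors over its multiplicities.
  Allowing every multiplicity function in the box only adds nonnegative terms, the sum over the box
  is a product of finite geometric sums, and each of these is at most its infinite series.\<close>

lemma sum_power_partitions_le:
  fixes x :: real
  assumes "0 < x" "x < 1"
  shows "(\<Sum>M\<in>partitions_upto N. x ^ \<Sum>\<^sub># M) \<le> (\<Prod>k\<in>{1..N}. 1 / (1 - x ^ k))"
proof -
  have eq: "x ^ \<Sum>\<^sub># M = (\<Prod>k\<in>{1..N}. x ^ (k * restrict (count M) {1..N} k))"
    if "M \<in> partitions_upto N" for M
    using sum_mset_nat_eq_sum[OF _ partition_parts_subset[OF that]]
    by (simp add: power_sum)
  have "(\<Sum>M\<in>partitions_upto N. x ^ \<Sum>\<^sub># M) =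
      (\<Sum>g\<in>(\<lambda>M. restrict (count M) {1..N}) ` partitions_upto N. \<Prod>k\<in>{1..N}. x ^ (k * g k))"
    by (subst sum.reindex[OF inj_on_multiplicities]) (auto intro!: sum.cong simp: eq)
  also have "\<dots> \<le> (\<Sum>g\<in>{1..N} \<rightarrow>\<^sub>E {..N}. \<Prod>k\<in>{1..N}. x ^ (k * g k))"
    using assms
    by (intro sum_mono2) (auto intro!: finite_PiE prod_nonneg simp: count_partition_le)
  also have "\<dots> = (\<Prod>k\<in>{1..N}. \<Sum>j\<in>{..N}. x ^ (k * j))"
    by (rule prod_sum_PiE[symmetric]) auto
  also have "\<dots> \<le> (\<Prod>k\<in>{1..N}. 1 / (1 - x ^ k))"
  proof (rule prod_mono)
    fix k assume "k \<in> {1..N}"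
    then have xk: "0 < x ^ k" "x ^ k < 1"
      using assms by (auto simp: power_less_one_iff)
    have "(\<Sum>j\<le>N. x ^ (k * j)) = (\<Sum>j<Suc N. (x ^ k) ^ j)"
      by (simp add: power_mult lessThan_Suc_atMost)
    also have "\<dots> \<le> (\<Sum>j. (x ^ k) ^ j)"
      using xk by (intro sum_le_suminf summable_geometric) auto
    also have "\<dots> = 1 / (1 - x ^ k)"
      using xk by (intro suminf_geometric) auto
    finally show "0 \<le> (\<Sum>j\<le>N. x ^ (k * j)) \<and> (\<Sum>j\<le>N. x ^ (k * j)) \<le> 1 / (1 - x ^ k)"
      using assms by (auto intro!: sum_nonneg)
  qed
  finally show ?thesis .
qed

text \<open>Partial fractions of 1 / (t + t^2 / 2), the bound given by the quadratic Taylor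
  polynomial. The subtracted term is what later produces the harmonic number.\<close>

lemma inverse_exp_minus_one_le:
  fixes t :: real
  assumes "t > 0"
  shows "1 / (exp t - 1) \<le> 1 / t - 1 / (t + 2)"
proof -
  have "1 + t + t\<^sup>2 / 2 \<le> exp t" using assms by (intro exp_lower_Taylor_quadratic) simp
  then have "t + t\<^sup>2 / 2 \<le> exp t - 1" by simp
  moreover have "0 < t + t\<^sup>2 / 2" using assms by (simp add: add_pos_pos)
  ultimately have "1 / (exp t - 1) \<le> 1 / (t + t\<^sup>2 / 2)"
    using assms by (intro divide_left_mono mult_pos_pos) auto
  also have "\<dots> = 1 / t - 1 / (t + 2)"
    using assms by (simp add: field_simps power2_eq_square)
  finally show ?thesis .
qed

lemma sum_exp_neg_multiples_le:
  fixes t :: real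
  assumes "t > 0"
  shows "(\<Sum>k\<in>{1..N}. exp (- t * real k)) \<le> 1 / (exp t - 1)"
proof -
  have q: "0 < exp (- t)" "exp (- t) < 1" using assms by auto
  have "(\<Sum>k\<in>{1..N}. exp (- t * real k)) = (\<Sum>k<N. exp (- t) * exp (- t) ^ k)"
    by (rule sum.reindex_bij_witness[of _ Suc "\<lambda>k. k - 1"])
       (auto simp: exp_of_nat_mult[symmetric] exp_add[symmetric] algebra_simps of_nat_diff)
  also have "\<dots> \<le> (\<Sum>k. exp (- t) * exp (- t) ^ k)"
    using q by (intro sum_le_suminf summable_mult summable_geometric) auto
  also have "\<dots> = exp (- t) * (1 / (1 - exp (- t)))"
    using q by (subst suminf_mult) (auto intro: summable_geometric simp: suminf_geometric)
  also have "\<dots> = 1 / (exp t - 1)"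
    using assms by (simp add: exp_minus field_simps)
  finally show ?thesis .
qed

text \<open>Expanding the logarithm of Euler's product gives \<open>\<Sum>\<^sub>m 1 / (m (exp (m s) - 1))\<close>. Replacing
  \<open>exp (m s) - 1\<close> by \<open>m s\<close> yields \<open>\<pi>\<^sup>2 / (6 s)\<close>; the first \<open>M\<close> terms alone save a third of the
  harmonic number of \<open>M\<close>.\<close>

lemma ln_euler_product_le:
  fixes s :: real
  assumes s: "s > 0" and M: "real M * s \<le> 1"
  shows "(\<Sum>k\<in>{1..N}. - ln (1 - exp (- s) ^ k)) \<le> pi\<^sup>2 / (6 * s) - harm M / 3"
proof -
  \<comment> \<open>\<open>f m\<close> collects the terms of degree \<open>m + 1\<close> of the
    logarithmic series over all factors of the product; the geometric sum over \<open>k\<close>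
    bounds it by \<open>1 / (Suc m * (exp (s * Suc m) - 1))\<close>.\<close>
  define f where "f m = (\<Sum>k\<in>{1..N}. exp (- (s * Suc m) * k)) / Suc m" for m :: nat
  \<comment> \<open>With \<open>t = s * Suc m\<close> the saving is 1 / (t + 2). It is replaced by
    1/3 when \<open>m < M\<close>, where t \<le> 1, and dropped for larger \<open>m\<close>.\<close>
  define g where "g m = 1 / s * (1 / (real m + 1)\<^sup>2) - (if m < M then 1 / (3 * real (Suc m)) else 0)" for m :: nat
  have "(\<lambda>m. exp (- (s * Suc m) * k) / Suc m) sums - ln (1 - exp (- s) ^ k)" if "k \<in> {1..N}" for k
  proof -
    define y where "y = exp (- s) ^ k"
    have y: "0 < y" "y < 1" using that s by (auto simp: y_def power_less_one_iff)
    have "(\<lambda>n. - ((- (- y)) ^ n) / of_nat n) sums ln (1 + (- y))"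
      using y by (intro ln_series') auto
    then have "(\<lambda>n. y ^ n / real n) sums - ln (1 - y)"
      using sums_minus by fastforce
    \<comment> \<open>The series starts at index 0, but its term there is a division by zero, hence
      0, and the shift changes nothing.\<close>
    then have "(\<lambda>n. y ^ Suc n / real (Suc n)) sums - ln (1 - y)"
      by (subst sums_Suc_iff) simp
    moreover have "y ^ Suc m = exp (- (s * Suc m) * k)" for m
      unfolding y_def power_mult[symmetric] exp_of_nat_mult[symmetric] by (simp add: algebra_simps)
    ultimately show ?thesis by (simp add: y_def)
  qed
  then have "(\<lambda>m. \<Sum>k\<in>{1..N}. exp (- (s * Suc m) * k) / Suc m) sums (\<Sum>k\<in>{1..N}. - ln (1 - exp (- s) ^ k))"
    by (rule sums_sum)
  then have f: "f sums (\<Sum>k\<in>{1..N}. - ln (1 - exp (- s) ^ k))"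
    unfolding f_def by (simp add: sum_divide_distrib)
  have "(\<lambda>m. 1 / s * (1 / (real m + 1)\<^sup>2)) sums (1 / s * (pi\<^sup>2 / 6))"
    using inverse_squares_sums by (intro sums_mult) (simp add: add.commute)
  moreover have "(\<lambda>m. if m < M then 1 / (3 * real (Suc m)) else 0) sums (\<Sum>m<M. 1 / (3 * real (Suc m)))"
    using sums_If_finite_set[of "{..<M}" "\<lambda>m. 1 / (3 * real (Suc m))"] by simp
  ultimately have g: "g sums (1 / s * (pi\<^sup>2 / 6) - (\<Sum>m<M. 1 / (3 * real (Suc m))))"
    unfolding g_def by (rule sums_diff)
  have "f m \<le> g m" for m
  proof -
    let ?t = "s * Suc m"
    have t: "?t > 0" using s by simp
    have "f m \<le> (1 / ?t - 1 / (?t + 2)) / Suc m"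
      unfolding f_def using sum_exp_neg_multiples_le[OF t, of N] inverse_exp_minus_one_le[OF t]
      by (intro divide_right_mono) (auto intro: order.trans)
    also have "\<dots> = 1 / s * (1 / (real m + 1)\<^sup>2) - 1 / ((?t + 2) * Suc m)"
      by (simp add: diff_divide_distrib power2_eq_square mult.assoc add.commute)
    also have "\<dots> \<le> g m"
    proof (cases "m < M")
      case True
      then have "?t \<le> real M * s" using s by simp
      then have "?t + 2 \<le> 3" using M by simp
      then have "(?t + 2) * Suc m \<le> 3 * real (Suc m)" by (intro mult_right_mono) auto
      moreover have "0 < (?t + 2) * Suc m" using t by simp
      ultimately have "1 / (3 * real (Suc m)) \<le> 1 / ((?t + 2) * Suc m)"
        by (intro frac_le; (assumption | simp))
      then show ?thesis using True unfolding g_def by simp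
    next
      case False
      then show ?thesis using t unfolding g_def by simp
    qed
    finally show ?thesis .
  qed
  then have "(\<Sum>k\<in>{1..N}. - ln (1 - exp (- s) ^ k)) \<le> 1 / s * (pi\<^sup>2 / 6) - (\<Sum>m<M. 1 / (3 * real (Suc m)))"
    by (rule sums_le[OF _ f g])
  also have "(\<Sum>m<M. 1 / (3 * real (Suc m))) = harm M / 3"
    unfolding harm_def sum_divide_distrib
    by (rule sum.reindex_bij_witness[of _ "\<lambda>k. k - 1" Suc]) (auto simp: field_simps)
  finally show ?thesis by simp
qed

text \<open>Since exp (-s) < 1, every partition of size at most \<open>N\<close> weighs at least the
  \<open>N\<close>-th power of exp (-s) in the generating function, so the count is at most exp (s
  N) times the product.\<close>

lemma card_partitions_upto_le:
  fixes s :: real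
  assumes s: "s > 0" and M: "real M * s \<le> 1"
  shows "card (partitions_upto N) \<le> exp (s * N + pi\<^sup>2 / (6 * s) - harm M / 3)"
proof -
  let ?x = "exp (- s)"
  have x: "0 < ?x" "?x < 1" using s by auto
  have "?x ^ N * card (partitions_upto N) = (\<Sum>M\<in>partitions_upto N. ?x ^ N)" by simp
  also have "\<dots> \<le> (\<Sum>M\<in>partitions_upto N. ?x ^ \<Sum>\<^sub># M)"
    using x by (intro sum_mono power_decreasing) (auto simp: partitions_upto_def)
  also have "\<dots> \<le> (\<Prod>k\<in>{1..N}. 1 / (1 - ?x ^ k))"
    by (rule sum_power_partitions_le[OF x])
  also have "\<dots> = (\<Prod>k\<in>{1..N}. exp (- ln (1 - ?x ^ k)))"
  proof (rule prod.cong)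
    fix k assume "k \<in> {1..N}"
    then have "?x ^ k < 1" using x s by (auto simp: power_less_one_iff)
    then show "1 / (1 - ?x ^ k) = exp (- ln (1 - ?x ^ k))"
      by (simp add: exp_minus field_simps)
  qed simp
  also have "\<dots> = exp (\<Sum>k\<in>{1..N}. - ln (1 - ?x ^ k))" by (simp add: exp_sum)
  also have "\<dots> \<le> exp (pi\<^sup>2 / (6 * s) - harm M / 3)"
    using ln_euler_product_le[OF s M] by simp
  finally have "exp (s * N) * (?x ^ N * card (partitions_upto N)) \<le>
      exp (s * N) * exp (pi\<^sup>2 / (6 * s) - harm M / 3)"
    by (intro mult_left_mono) auto
  moreover have "exp (s * N) * ?x ^ N = 1"
    by (simp add: exp_of_nat_mult[symmetric] exp_add[symmetric] algebra_simps)
  ultimately show ?thesis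
    by (simp add: mult.assoc[symmetric] exp_add[symmetric] add_diff_eq)
qed

text \<open>\<open>M\<close> is fixed first, so large that exp (- harm M / 3) \<le> C. Only then is
  \<open>N\<close> sent to infinity, which makes \<open>s\<close> small enough for the first
  \<open>M\<close> terms to give their saving.\<close>

lemma eventually_card_partitions_upto_le:
  fixes C :: real
  assumes "C > 0"
  shows "eventually (\<lambda>N. card (partitions_upto N) \<le> C * exp (pi * sqrt (2 * real N / 3))) sequentially"
proof -
  have "eventually (\<lambda>M. harm M \<ge> 3 * - ln C) sequentially"
    using harm_at_top unfolding filterlim_at_top by blast
  then obtain M :: nat where M: "harm M \<ge> 3 * - ln C"
    using eventually_happens by force
  \<comment> \<open>For \<open>s = pi / sqrt (6 * N)\<close> the condition M s \<le> 1 reads (M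
    pi)^2 \<le> 6 N; the added 1 keeps \<open>N\<close> positive.\<close>
  have "eventually (\<lambda>N. real N \<ge> (real M * pi)\<^sup>2 / 6 + 1) sequentially"
    using filterlim_real_sequentially unfolding filterlim_at_top by blast
  then show ?thesis
  proof eventually_elim
    case (elim N)
    let ?s = "pi / sqrt (6 * N)"
    have N: "real N > 0" using elim by (smt (verit) divide_nonneg_pos zero_le_power2)
    then have s: "?s > 0" by simp
    have "(real M * pi)\<^sup>2 \<le> 6 * real N" using elim by simp
    then have "real M * pi \<le> sqrt (6 * real N)" by (rule real_le_rsqrt)
    then have Ms: "real M * ?s \<le> 1" using N by (simp add: field_simps)
    have r: "sqrt (2 * real N / 3) = sqrt (6 * real N) / 3"
    proof -
      have "2 * real N / 3 = (6 * real N) / 3\<^sup>2" by (simp add: power2_eq_square)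
      then show ?thesis by (simp only: real_sqrt_divide real_sqrt_abs abs_numeral)
    qed
    have sq: "sqrt (6 * real N) * sqrt (6 * real N) = 6 * real N" using N by simp
    have e1: "?s * N = pi * sqrt (6 * real N) / 6"
      using N sq by (simp add: field_simps)
    have e2: "pi\<^sup>2 / (6 * ?s) = pi * sqrt (6 * real N) / 6"
      by (simp add: power2_eq_square)
    have "card (partitions_upto N) \<le> exp (?s * N + pi\<^sup>2 / (6 * ?s) - harm M / 3)"
      by (rule card_partitions_upto_le[OF s Ms])
    also have "?s * N + pi\<^sup>2 / (6 * ?s) - harm M / 3 = pi * sqrt (2 * real N / 3) - harm M / 3"
      unfolding e1 e2 r by simp
    also have "exp \<dots> \<le> exp (pi * sqrt (2 * real N / 3) + ln C)"
      using M by simp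
    also have "\<dots> = C * exp (pi * sqrt (2 * real N / 3))"
      using assms by (simp add: exp_add)
    finally show ?case .
  qed
qed

lemma sum_num_partitions_le_card: "(\<Sum>r = 1..N. num_partitions r) \<le> card (partitions_upto N)"
  unfolding sum_num_partitions
  by (intro card_mono finite_partitions_upto) (auto simp: partitions_upto_def)

section \<open>Kernels, adjoints and traces of matrices\<close>

lemma kernel_dim_le:
  fixes A :: "'a :: field mat"
  assumes A: "A \<in> carrier_mat nr nc"
  shows "kernel_dim A \<le> nc"
proof -
  interpret kernel nr nc A by unfold_locales (rule A)
  obtain B where B: "finite B" "basis B" using kernel_basis_exists[OF A] by blast
  have sub: "B \<subseteq> mat_kernel A" and li: "lin_indpt B"
    using B(2) by (auto simp: Ker.basis_def)
  have "B \<subseteq> carrier NC.V" using sub mat_kernel_carrier[OF A] by auto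
  moreover have "NC.lin_indpt B" using li lindep_same[OF sub] by blast
  ultimately have "card B \<le> NC.dim" by (intro NC.li_le_dim(2)) auto
  then show ?thesis using Ker.dim_basis[OF B] by (simp add: NC.dim_is_n)
qed

text \<open>A basis of the smaller kernel stays independent when a vector of the larger kernel
  outside it is added. Strictness serves both the choice of an element with maximal kernel and the
  count of orthogonal projections.\<close>

lemma kernel_dim_less:
  fixes A B :: "'a :: field mat"
  assumes A: "A \<in> carrier_mat nr nc" and B: "B \<in> carrier_mat nr' nc"
    and less: "mat_kernel A \<subset> mat_kernel B"
  shows "kernel_dim A < kernel_dim B"
proof -
  interpret A: kernel nr nc A by unfold_locales (rule A)
  interpret B: kernel nr' nc B by unfold_locales (rule B)
  obtain X where X: "finite X" "A.basis X" using kernel_basis_exists[OF A] by blast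
  obtain Y where Y: "finite Y" "B.basis Y" using kernel_basis_exists[OF B] by blast
  have sub: "X \<subseteq> mat_kernel A" and li: "A.lin_indpt X" and span: "A.span X = mat_kernel A"
    using X(2) by (auto simp: A.Ker.basis_def)
  obtain w where w: "w \<in> mat_kernel B" "w \<notin> mat_kernel A" using less by blast
  have XV: "X \<subseteq> carrier_vec nc" and wV: "w \<in> carrier_vec nc"
    using sub w mat_kernel_carrier[OF A] mat_kernel_carrier[OF B] by auto
  have liX: "A.NC.lin_indpt X" using li by (simp only: A.lindep_same[OF sub] not_False_eq_True)
  have wX: "w \<notin> X" using sub w by auto
  have "w \<notin> A.NC.span X" using A.span_same[OF sub] span w by simp
  then have "A.NC.lin_indpt (X \<union> {w})"
    by (simp only: A.NC.lin_dep_iff_in_span[OF XV liX wV wX] not_False_eq_True)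
  moreover have Xw: "X \<union> {w} \<subseteq> mat_kernel B" using sub less w by auto
  ultimately have liXw: "B.lin_indpt (X \<union> {w})" by (simp only: B.lindep_same[OF Xw] not_False_eq_True)
  have "B.Ker.fin_dim"
    unfolding B.Ker.fin_dim_def using Y by (intro exI[of _ Y]) (simp add: B.Ker.basis_def)
  then have "card (X \<union> {w}) \<le> B.dim" by (rule B.Ker.li_le_dim(2)[OF _ Xw liXw])
  then show ?thesis using X(1) wX A.Ker.dim_basis[OF X] by simp
qed

lemma mat_adjoint_carrier:
  "A \<in> carrier_mat n m \<Longrightarrow> mat_adjoint A \<in> carrier_mat m n"
  by (auto simp: mat_adjoint_def mat_of_rows_def)

lemma dim_mat_adjoint [simp]:
  "dim_row (mat_adjoint A) = dim_col A" "dim_col (mat_adjoint A) = dim_row A"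
  by (auto simp: mat_adjoint_def mat_of_rows_def)

lemma mat_adjoint_index:
  fixes A :: "complex mat"
  assumes "A \<in> carrier_mat n m" "i < m" "j < n"
  shows "mat_adjoint A $$ (i, j) = cnj (A $$ (j, i))"
  using assms by (auto simp: mat_adjoint_def mat_of_rows_def)

lemma index_mult_mat_sum:
  fixes A B :: "'a :: semiring_0 mat"
  assumes "A \<in> carrier_mat n m" "B \<in> carrier_mat m l" "i < n" "j < l"
  shows "(A * B) $$ (i, j) = (\<Sum>k<m. A $$ (i, k) * B $$ (k, j))"
  using assms by (auto simp: scalar_prod_def atLeast0LessThan intro!: sum.cong)

lemma mat_adjoint_mult:
  fixes A B :: "complex mat"
  assumes "A \<in> carrier_mat n m" "B \<in> carrier_mat m l"
  shows "mat_adjoint (A * B) = mat_adjoint B * mat_adjoint A"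
proof (rule eq_matI)
  fix i j assume "i < dim_row (mat_adjoint B * mat_adjoint A)" "j < dim_col (mat_adjoint B * mat_adjoint A)"
  then have ij: "i < l" "j < n"
    using assms by auto
  have "mat_adjoint (A * B) $$ (i, j) = cnj ((A * B) $$ (j, i))"
    by (rule mat_adjoint_index[OF mult_carrier_mat[OF assms] ij])
  also have "\<dots> = (\<Sum>k<m. mat_adjoint B $$ (i, k) * mat_adjoint A $$ (k, j))"
    unfolding index_mult_mat_sum[OF assms ij(2,1)] cnj_sum
    by (intro sum.cong)
       (simp_all add: mat_adjoint_index[OF assms(2) ij(1)] mat_adjoint_index[OF assms(1) _ ij(2)] mult.commute)
  also have "\<dots> = (mat_adjoint B * mat_adjoint A) $$ (i, j)"
    using index_mult_mat_sum[OF mat_adjoint_carrier[OF assms(2)] mat_adjoint_carrier[OF assms(1)] ij]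
    by (rule sym)
  finally show "mat_adjoint (A * B) $$ (i, j) = (mat_adjoint B * mat_adjoint A) $$ (i, j)" .
qed (use assms in auto)

lemma mat_adjoint_adjoint:
  fixes A :: "complex mat"
  shows "mat_adjoint (mat_adjoint A) = A"
proof -
  have A: "A \<in> carrier_mat (dim_row A) (dim_col A)" by simp
  show ?thesis
    by (rule eq_matI) (auto simp: mat_adjoint_index[OF mat_adjoint_carrier[OF A]] mat_adjoint_index[OF A])
qed

lemma mat_adjoint_add:
  fixes A B :: "complex mat"
  assumes "A \<in> carrier_mat n m" "B \<in> carrier_mat n m"
  shows "mat_adjoint (A + B) = mat_adjoint A + mat_adjoint B"
proof -
  have AB: "A + B \<in> carrier_mat n m" using assms by simp
  show ?thesis
    by (rule eq_matI)
       (insert assms, auto simp: mat_adjoint_index[OF assms(1)] mat_adjoint_index[OF assms(2)] mat_adjoint_index[OF AB])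
qed

lemma mat_adjoint_smult:
  fixes A :: "complex mat"
  shows "mat_adjoint (c \<cdot>\<^sub>m A) = cnj c \<cdot>\<^sub>m mat_adjoint A"
proof -
  have A: "A \<in> carrier_mat (dim_row A) (dim_col A)" by simp
  have cA: "c \<cdot>\<^sub>m A \<in> carrier_mat (dim_row A) (dim_col A)" by simp
  show ?thesis
    by (rule eq_matI)
       (auto simp: mat_adjoint_index[OF A] mat_adjoint_index[OF cA])
qed

lemma mat_trace_mult:
  assumes "A \<in> carrier_mat n m" "B \<in> carrier_mat m n"
  shows "mat_trace (A * B) = (\<Sum>i<n. \<Sum>k<m. A $$ (i, k) * B $$ (k, i))"
  unfolding mat_trace_def using assms by (intro sum.cong index_mult_mat_sum[OF assms]) auto

lemma mat_trace_mult_commute: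
  assumes "A \<in> carrier_mat n m" "B \<in> carrier_mat m n"
  shows "mat_trace (A * B) = mat_trace (B * A)"
  unfolding mat_trace_mult[OF assms] mat_trace_mult[OF assms(2,1)]
  by (subst sum.swap) (simp add: mult.commute)

lemma mat_trace_adjoint_mult:
  assumes "A \<in> carrier_mat n m"
  shows "mat_trace (mat_adjoint A * A) = of_real (\<Sum>i<m. \<Sum>k<n. (cmod (A $$ (k, i)))\<^sup>2)"
proof -
  have "mat_trace (mat_adjoint A * A) = (\<Sum>i<m. \<Sum>k<n. cnj (A $$ (k, i)) * A $$ (k, i))"
    using assms by (subst mat_trace_mult) (auto simp: mat_adjoint_index intro!: sum.cong)
  also have "\<dots> = (\<Sum>i<m. \<Sum>k<n. of_real ((cmod (A $$ (k, i)))\<^sup>2))"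
    by (intro sum.cong refl) (metis complex_norm_square mult.commute)
  finally show ?thesis by simp
qed

lemma mat_trace_adjoint_mult_pos:
  assumes "A \<in> carrier_mat n m" "A \<noteq> 0\<^sub>m n m"
  shows "\<exists>t>0. mat_trace (mat_adjoint A * A) = of_real t"
proof -
  obtain i k where ik: "i < m" "k < n" "A $$ (k, i) \<noteq> 0"
  proof (rule ccontr)
    assume "\<not> thesis"
    then have "A = 0\<^sub>m n m" using that assms(1) by (intro eq_matI) auto
    then show False using assms(2) by simp
  qed
  have "0 < (\<Sum>k<n. (cmod (A $$ (k, i)))\<^sup>2)"
    using ik by (intro sum_pos2[of "{..<n}" k]) auto
  then have "0 < (\<Sum>i<m. \<Sum>k<n. (cmod (A $$ (k, i)))\<^sup>2)"
    using ik by (intro sum_pos2[of "{..<m}" i]) (auto intro: sum_nonneg)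
  then show ?thesis using mat_trace_adjoint_mult[OF assms(1)] by blast
qed

text \<open>The trace of \<open>mat_adjoint A * A\<close> is the sum of the squared moduli of the
  entries of \<open>A\<close>, so it vanishes only for \<open>A = 0\<close>.\<close>

lemma adjoint_mult_eq_0_iff:
  fixes A :: "complex mat"
  assumes "A \<in> carrier_mat n m"
  shows "mat_adjoint A * A = 0\<^sub>m m m \<longleftrightarrow> A = 0\<^sub>m n m"
proof
  assume "mat_adjoint A * A = 0\<^sub>m m m"
  then have "mat_trace (mat_adjoint A * A) = 0" by (simp add: mat_trace_def)
  then show "A = 0\<^sub>m n m" using mat_trace_adjoint_mult_pos[OF assms] by force
next
  assume A: "A = 0\<^sub>m n m"
  show "mat_adjoint A * A = 0\<^sub>m m m"
    unfolding A by (rule right_mult_zero_mat[OF mat_adjoint_carrier[OF zero_carrier_mat]])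
qed

text \<open>If all eigenvalues vanish, a triangular form \<open>B\<close> of \<open>A\<close> has zero diagonal, so that
  \<open>tr (A\<^sup>* A) = tr (A\<^sup>2) = tr (B\<^sup>2) = 0\<close>.\<close>

lemma hermitian_ex_nonzero_eigenvalue:
  fixes A :: "complex mat"
  assumes A: "A \<in> carrier_mat n n" and herm: "mat_adjoint A = A" and nz: "A \<noteq> 0\<^sub>m n n"
  shows "\<exists>\<mu> v. \<mu> \<noteq> 0 \<and> v \<in> carrier_vec n \<and> v \<noteq> 0\<^sub>v n \<and> A *\<^sub>v v = \<mu> \<cdot>\<^sub>v v"
proof (rule ccontr)
  assume neg: "\<not> ?thesis"
  obtain as where as: "char_poly A = (\<Prod>a\<leftarrow>as. [:- a, 1:])"
    using char_poly_factorized[OF A] by blast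
  obtain B where B: "B \<in> carrier_mat n n" and ut: "upper_triangular B" and sim: "similar_mat A B"
    using schur_decomposition_exists[OF A as] by (elim bexE conjE)
  have diag: "B $$ (i, i) = 0" if "i < n" for i
  proof (rule ccontr)
    assume nz: "B $$ (i, i) \<noteq> 0"
    have "B $$ (i, i) \<in> set (diag_mat B)" using that B by (auto simp: diag_mat_def)
    then have "\<exists>q\<in>set (map (\<lambda>a. [:- a, 1:]) (diag_mat B)). poly q (B $$ (i, i)) = 0"
      by (intro bexI[of _ "[:- (B $$ (i, i)), 1:]"]) simp_all
    then have "poly (char_poly B) (B $$ (i, i)) = 0"
      unfolding char_poly_upper_triangular[OF B ut] poly_prod_list prod_list_zero_iff
      by (metis (no_types, lifting) imageE image_eqI list.set_map)
    then have "eigenvalue A (B $$ (i, i))"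
      using eigenvalue_root_char_poly[OF A] char_poly_similar[OF sim] by simp
    then show False using neg nz A unfolding eigenvalue_def eigenvector_def by auto
  qed
  obtain P Q where w: "similar_mat_wit A B P Q" using sim unfolding similar_mat_def by blast
  note PQ = similar_mat_witD2(6,7,2,3)[OF A w]
  have QPB: "Q * (P * X) = X" if "X \<in> carrier_mat n n" for X
    using assoc_mult_mat[OF PQ(2,1) that] PQ(3) that by simp
  have BBQ: "B * (B * Q) \<in> carrier_mat n n" using PQ(2) B by simp
  \<comment> \<open>The inner \<open>Q * P\<close> cancels, and cyclicity of the trace removes the
    outer conjugation, leaving the trace of \<open>B * B\<close>.\<close>
  have "A * A = P * (B * (Q * (P * (B * Q))))"
    unfolding PQ(4) using PQ(1,2) B by (simp add: assoc_mult_mat[of _ n n _ n _ n])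
  then have "A * A = P * (B * (B * Q))" using QPB PQ(2) B by simp
  then have "mat_trace (A * A) = mat_trace (P * (B * (B * Q)))" by (rule arg_cong)
  also have "\<dots> = mat_trace ((B * (B * Q)) * P)"
    by (rule mat_trace_mult_commute[OF PQ(1) BBQ])
  also have "\<dots> = mat_trace (B * B)"
  proof (rule arg_cong[where f = mat_trace])
    have "(B * (B * Q)) * P = B * ((B * Q) * P)"
      using PQ(1,2) B by (intro assoc_mult_mat mult_carrier_mat)
    also have "(B * Q) * P = B" unfolding assoc_mult_mat[OF B PQ(2,1)] PQ(3) by (rule right_mult_one_mat[OF B])
    finally show "(B * (B * Q)) * P = B * B" .
  qed
  also have "mat_trace (B * B) = 0"
    unfolding mat_trace_mult[OF B B]
  proof (intro sum.neutral ballI)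
    fix i k assume "i \<in> {..<n}" "k \<in> {..<n}"
    then show "B $$ (i, k) * B $$ (k, i) = 0"
      using diag[of i] upper_triangularD[OF ut] B by (cases i k rule: linorder_cases) auto
  qed
  finally have "mat_trace (mat_adjoint A * A) = 0" by (simp add: herm)
  then show False using mat_trace_adjoint_mult_pos[OF A nz] by force
qed

section \<open>Minimal projections\<close>

text \<open>All matrices of the algebra are square of one size; with the dimensions fixed, the side
  conditions of these laws are plain memberships in \<open>carrier_mat N N\<close>.\<close>

lemmas square_mult_assoc = assoc_mult_mat[of _ N N _ N _ N] for N
lemmas square_mult_simps =
  square_mult_assoc[where ?'a = complex]
  mult_smult_distrib[of _ N N _ N, where ?'a = complex]
  mult_smult_assoc_mat[of _ N N _ N, where ?'a = complex]
  mult_carrier_mat[of _ N N _ N, where ?'a = complex]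
  mat_adjoint_carrier[of _ N N, where ?'a = complex] for N

lemma mult_mat_zero_vec:
  fixes A :: "'a :: semiring_0 mat"
  assumes "A \<in> carrier_mat nr nc"
  shows "A *\<^sub>v 0\<^sub>v nc = 0\<^sub>v nr"
  using assms by (intro eq_vecI) (auto simp: scalar_prod_def)

lemma smult_zero_vec:
  fixes c :: "'a :: mult_zero"
  shows "c \<cdot>\<^sub>v 0\<^sub>v n = 0\<^sub>v n"
  by (intro eq_vecI) auto

lemma smult_smult_mat:
  fixes A :: "'a :: semigroup_mult mat"
  shows "a \<cdot>\<^sub>m (b \<cdot>\<^sub>m A) = (a * b) \<cdot>\<^sub>m A"
  by (rule eq_matI) (auto simp: mult.assoc)

lemma one_smult_mat [simp]:
  fixes A :: "'a :: monoid_mult mat"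
  shows "1 \<cdot>\<^sub>m A = A"
  by (rule eq_matI) auto

lemma smult_mat_mult_vec:
  fixes A :: "'a :: field mat"
  assumes "A \<in> carrier_mat nr nc" "v \<in> carrier_vec nc"
  shows "(k \<cdot>\<^sub>m A) *\<^sub>v v = k \<cdot>\<^sub>v (A *\<^sub>v v)"
  using assms by (intro eq_vecI) (auto simp: scalar_prod_def sum_distrib_left mult.assoc)

lemma smult_mat_cancel:
  fixes A :: "'a :: idom mat"
  assumes "A \<in> carrier_mat n m" "A \<noteq> 0\<^sub>m n m" "a \<cdot>\<^sub>m A = b \<cdot>\<^sub>m A"
  shows "a = b"
proof -
  obtain i j where ij: "i < n" "j < m" "A $$ (i, j) \<noteq> 0"
  proof (rule ccontr)
    assume "\<not> thesis"
    then have "A = 0\<^sub>m n m" using that assms(1) by (intro eq_matI) auto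
    then show False using assms(2) by simp
  qed
  have "(a \<cdot>\<^sub>m A) $$ (i, j) = (b \<cdot>\<^sub>m A) $$ (i, j)" using assms(3) by simp
  then show ?thesis using ij assms(1) by simp
qed

lemma add_smult_uminus_eq_0:
  fixes A B :: "complex mat"
  assumes "A \<in> carrier_mat n m" "B \<in> carrier_mat n m" "A + (- c) \<cdot>\<^sub>m B = 0\<^sub>m n m"
  shows "A = c \<cdot>\<^sub>m B"
proof (rule eq_matI)
  fix i j assume "i < dim_row (c \<cdot>\<^sub>m B)" "j < dim_col (c \<cdot>\<^sub>m B)"
  then have ij: "i < n" "j < m" using assms(2) by auto
  have "(A + (- c) \<cdot>\<^sub>m B) $$ (i, j) = 0" using ij assms(3) by simp
  then show "A $$ (i, j) = (c \<cdot>\<^sub>m B) $$ (i, j)" using ij assms(1,2) by simp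
qed (use assms in auto)

lemma mem_mat_kernel_iff:
  "A \<in> carrier_mat n m \<Longrightarrow> v \<in> mat_kernel A \<longleftrightarrow> v \<in> carrier_vec m \<and> A *\<^sub>v v = 0\<^sub>v n"
  by (auto simp: mat_kernel_def)

locale matrix_star_algebra =
  fixes N :: nat and S :: "complex mat set"
  assumes subalgebra: "star_subalgebra S (mat_star_algebra N)"
begin

lemma mem_carrier: "x \<in> S \<Longrightarrow> x \<in> carrier_mat N N"
  and mem_zero: "0\<^sub>m N N \<in> S"
  and mem_add: "x \<in> S \<Longrightarrow> y \<in> S \<Longrightarrow> x + y \<in> S"
  and mem_smult: "x \<in> S \<Longrightarrow> c \<cdot>\<^sub>m x \<in> S"
  and mem_mult: "x \<in> S \<Longrightarrow> y \<in> S \<Longrightarrow> x * y \<in> S"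
  and mem_adjoint: "x \<in> S \<Longrightarrow> mat_adjoint x \<in> S"
  using subalgebra by (auto simp: star_subalgebra_def mat_star_algebra_def)

lemmas mem_closed = mem_zero mem_add mem_smult mem_mult mem_adjoint

end

text \<open>Minimality is expressed by the one-dimensional corner p S p instead of the order on
  projections; in this form it directly yields the scalars that become coefficients.\<close>

definition minimal_projection :: "nat \<Rightarrow> complex mat set \<Rightarrow> complex mat \<Rightarrow> bool" where
  "minimal_projection N S p \<longleftrightarrow> p \<in> S \<and> p \<noteq> 0\<^sub>m N N \<and> p * p = p \<and> mat_adjoint p = p \<and>
     (\<forall>x\<in>S. \<exists>c. p * x * p = c \<cdot>\<^sub>m p)"

context matrix_star_algebra
begin

text \<open>Take \<open>x \<noteq> 0\<close> in \<open>S\<close> with maximal kernel. If \<open>\<mu> \<noteq> 0\<close> is an eigenvalue of \<open>g = x\<^sup>* x\<close>, then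
  \<open>g\<^sup>2 - \<mu> g\<close> has a larger kernel, hence vanishes, and \<open>p = g / \<mu>\<close> is a projection. By the same
  argument every hermitian element of \<open>p S p\<close> is a multiple of \<open>p\<close>.\<close>

lemma ex_minimal_projection:
  assumes "S \<noteq> {0\<^sub>m N N}"
  shows "\<exists>p. minimal_projection N S p"
proof -
  note C = mem_carrier mat_adjoint_carrier[of _ N N]
  obtain x0 where "x0 \<in> S \<and> x0 \<noteq> 0\<^sub>m N N" using assms mem_zero by blast
  moreover have "\<forall>y. y \<in> S \<and> y \<noteq> 0\<^sub>m N N \<longrightarrow> kernel_dim y < Suc N"
    using kernel_dim_le[OF mem_carrier] by (simp add: less_Suc_eq_le)
  ultimately have "\<exists>x. (x \<in> S \<and> x \<noteq> 0\<^sub>m N N) \<and>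
      (\<forall>y. y \<in> S \<and> y \<noteq> 0\<^sub>m N N \<longrightarrow> kernel_dim y \<le> kernel_dim x)"
    by (rule ex_has_greatest_nat)
  then obtain x where x: "x \<in> S" "x \<noteq> 0\<^sub>m N N"
    and max: "\<And>y. y \<in> S \<Longrightarrow> y \<noteq> 0\<^sub>m N N \<Longrightarrow> kernel_dim y \<le> kernel_dim x"
    by auto
  \<comment> \<open>The form in which the maximality of the kernel is applied, once to g^2 - \<mu> g
    and once to y - \<nu> p.\<close>
  have vanish: "z = 0\<^sub>m N N" if "z \<in> S" "mat_kernel x \<subset> mat_kernel z" for z
  proof (rule ccontr)
    assume "z \<noteq> 0\<^sub>m N N"
    then show False
      using kernel_dim_less[OF mem_carrier[OF x(1)] mem_carrier[OF that(1)] that(2)] max[OF that(1)]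
      by simp
  qed
  have xC: "x \<in> carrier_mat N N" "mat_adjoint x \<in> carrier_mat N N"
    using mem_carrier[OF x(1)] by (simp_all add: mat_adjoint_carrier)
  define g where "g = mat_adjoint x * x"
  have gS: "g \<in> S" unfolding g_def using x by (intro mem_closed)
  then have gC: "g \<in> carrier_mat N N" by (rule C)
  have g_adj: "mat_adjoint g = g"
    unfolding g_def mat_adjoint_mult[OF xC(2,1)] mat_adjoint_adjoint by (rule refl)
  have g_nz: "g \<noteq> 0\<^sub>m N N" unfolding g_def using adjoint_mult_eq_0_iff[OF xC(1)] x(2) by simp
  have ker_g: "g *\<^sub>v w = 0\<^sub>v N" if "w \<in> mat_kernel x" for w
  proof -
    have w: "w \<in> carrier_vec N" "x *\<^sub>v w = 0\<^sub>v N" using that mem_mat_kernel_iff[OF xC(1)] by auto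
    have "g *\<^sub>v w = mat_adjoint x *\<^sub>v (x *\<^sub>v w)"
      unfolding g_def using xC w(1) by (intro assoc_mult_mat_vec)
    also have "\<dots> = 0\<^sub>v N" unfolding w(2) by (rule mult_mat_zero_vec[OF xC(2)])
    finally show ?thesis .
  qed
  obtain \<mu> v where \<mu>: "\<mu> \<noteq> 0" and v: "v \<in> carrier_vec N" "v \<noteq> 0\<^sub>v N" "g *\<^sub>v v = \<mu> \<cdot>\<^sub>v v"
    using hermitian_ex_nonzero_eigenvalue[OF gC g_adj g_nz] by blast
  have gg: "g * g = \<mu> \<cdot>\<^sub>m g"
  proof (rule add_smult_uminus_eq_0[OF _ gC])
    let ?h = "g * g + (- \<mu>) \<cdot>\<^sub>m g"
    have hC: "?h \<in> carrier_mat N N" using gC by auto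
    have h: "?h *\<^sub>v w = g *\<^sub>v (g *\<^sub>v w) + (- \<mu>) \<cdot>\<^sub>v (g *\<^sub>v w)" if "w \<in> carrier_vec N" for w
      using gC that by (simp add: add_mult_distrib_mat_vec[of _ N N] smult_mat_mult_vec[of _ N N] assoc_mult_mat_vec[of _ N N _ N])
    show "?h = 0\<^sub>m N N"
    proof (rule vanish)
      show "?h \<in> S" using gS by (intro mem_closed)
      have "w \<in> mat_kernel ?h" if "w \<in> mat_kernel x" for w
      proof -
        have w: "w \<in> carrier_vec N" using that mem_mat_kernel_iff[OF xC(1)] by auto
        have "g *\<^sub>v 0\<^sub>v N = 0\<^sub>v N" by (rule mult_mat_zero_vec[OF gC])
        then show ?thesis
          using w ker_g[OF that] mem_mat_kernel_iff[OF hC] h[OF w] by auto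
      qed
      moreover have "v \<in> mat_kernel ?h"
      proof -
        have "?h *\<^sub>v v = \<mu> \<cdot>\<^sub>v (\<mu> \<cdot>\<^sub>v v) + (- \<mu>) \<cdot>\<^sub>v (\<mu> \<cdot>\<^sub>v v)"
          unfolding h[OF v(1)] v(3) mult_mat_vec[OF gC v(1)] by (rule refl)
        also have "\<dots> = 0\<^sub>v N" using v(1) by (intro eq_vecI) auto
        finally show ?thesis using mem_mat_kernel_iff[OF hC] v(1) by auto
      qed
      moreover have "v \<notin> mat_kernel x"
      proof
        assume "v \<in> mat_kernel x"
        then have "\<mu> \<cdot>\<^sub>v v = 0\<^sub>v N" using ker_g v(3) by simp
        then have "(1 / \<mu>) \<cdot>\<^sub>v (\<mu> \<cdot>\<^sub>v v) = 0\<^sub>v N" by (simp only: smult_zero_vec)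
        then show False using \<mu> v(2) by (simp add: smult_smult_assoc)
      qed
      ultimately show "mat_kernel x \<subset> mat_kernel ?h" by blast
    qed
  qed (use gC in simp)
  have real: "cnj \<mu> = \<mu>"
  proof (rule smult_mat_cancel[OF gC g_nz])
    have "mat_adjoint (g * g) = mat_adjoint g * mat_adjoint g" using gC gC by (rule mat_adjoint_mult)
    then show "cnj \<mu> \<cdot>\<^sub>m g = \<mu> \<cdot>\<^sub>m g" unfolding g_adj gg by (simp add: mat_adjoint_smult g_adj)
  qed
  define p where "p = (1 / \<mu>) \<cdot>\<^sub>m g"
  have pS: "p \<in> S" unfolding p_def using gS by (intro mem_closed)
  then have pC: "p \<in> carrier_mat N N" by (rule C)
  have p_adj: "mat_adjoint p = p" by (simp add: p_def mat_adjoint_smult g_adj real)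
  have "\<mu> \<cdot>\<^sub>m p = g" using \<mu> by (simp add: p_def smult_smult_mat)
  then have p_nz: "p \<noteq> 0\<^sub>m N N" using g_nz by auto
  have pp: "p * p = p"
    unfolding p_def using gC \<mu> by (simp add: square_mult_simps[where N = N] gg smult_smult_mat)
  have ker_p: "p *\<^sub>v w = 0\<^sub>v N" if "w \<in> mat_kernel x" for w
  proof -
    have w: "w \<in> carrier_vec N" using that mem_mat_kernel_iff[OF xC(1)] by auto
    show ?thesis unfolding p_def smult_mat_mult_vec[OF gC w] ker_g[OF that] by (rule smult_zero_vec)
  qed
  have herm: "\<exists>c. y = c \<cdot>\<^sub>m p" if y: "y \<in> S" "p * y = y" "y * p = y" "mat_adjoint y = y" for y
  proof (cases "y = 0\<^sub>m N N")
    case True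
    then have "y = 0 \<cdot>\<^sub>m p" using pC by (intro eq_matI) auto
    then show ?thesis by blast
  next
    case False
    have yC: "y \<in> carrier_mat N N" using y(1) by (rule C)
    obtain \<nu> w where \<nu>: "\<nu> \<noteq> 0" and w: "w \<in> carrier_vec N" "w \<noteq> 0\<^sub>v N" "y *\<^sub>v w = \<nu> \<cdot>\<^sub>v w"
      using hermitian_ex_nonzero_eigenvalue[OF yC y(4) False] by blast
    \<comment> \<open>As \<nu> is nonzero, the eigenvector \<open>w\<close> lies in the range of
      \<open>y\<close>, hence is fixed by \<open>p\<close>. Since \<open>p\<close> kills the kernel
      of \<open>x\<close>, \<open>w\<close> is outside that kernel, which makes the inclusion of
      kernels strict.\<close>
    have "p *\<^sub>v (\<nu> \<cdot>\<^sub>v w) = \<nu> \<cdot>\<^sub>v w"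
      using assoc_mult_mat_vec[OF pC yC w(1)] by (simp add: y(2) w(3))
    then have "\<nu> \<cdot>\<^sub>v (p *\<^sub>v w) = \<nu> \<cdot>\<^sub>v w" using mult_mat_vec[OF pC w(1)] by simp
    then have "(1 / \<nu>) \<cdot>\<^sub>v (\<nu> \<cdot>\<^sub>v (p *\<^sub>v w)) = (1 / \<nu>) \<cdot>\<^sub>v (\<nu> \<cdot>\<^sub>v w)" by simp
    then have pw: "p *\<^sub>v w = w" using \<nu> by (simp add: smult_smult_assoc)
    have "y = \<nu> \<cdot>\<^sub>m p"
    proof (rule add_smult_uminus_eq_0[OF yC pC], rule vanish)
      let ?z = "y + (- \<nu>) \<cdot>\<^sub>m p"
      show "?z \<in> S" using y(1) pS by (intro mem_closed)
      have zC: "?z \<in> carrier_mat N N" using yC pC by auto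
      have z: "?z *\<^sub>v u = y *\<^sub>v u + (- \<nu>) \<cdot>\<^sub>v (p *\<^sub>v u)" if "u \<in> carrier_vec N" for u
        using pC yC that by (simp add: add_mult_distrib_mat_vec[of _ N N] smult_mat_mult_vec[of _ N N])
      have "u \<in> mat_kernel ?z" if "u \<in> mat_kernel x" for u
      proof -
        have u: "u \<in> carrier_vec N" using that mem_mat_kernel_iff[OF xC(1)] by auto
        have "y *\<^sub>v u = y *\<^sub>v (p *\<^sub>v u)" using assoc_mult_mat_vec[OF yC pC u] by (simp add: y(3))
        also have "\<dots> = 0\<^sub>v N" unfolding ker_p[OF that] by (rule mult_mat_zero_vec[OF yC(1)])
        finally show ?thesis using mem_mat_kernel_iff[OF zC] z[OF u] ker_p[OF that] u by auto
      qed
      moreover have "w \<in> mat_kernel ?z"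
      proof -
        have "?z *\<^sub>v w = \<nu> \<cdot>\<^sub>v w + (- \<nu>) \<cdot>\<^sub>v w" unfolding z[OF w(1)] w(3) pw by (rule refl)
        also have "\<dots> = 0\<^sub>v N" using w(1) by (intro eq_vecI) auto
        finally show ?thesis using mem_mat_kernel_iff[OF zC] w(1) by auto
      qed
      moreover have "w \<notin> mat_kernel x" using ker_p pw w(2) by auto
      ultimately show "mat_kernel x \<subset> mat_kernel ?z" by blast
    qed
    then show ?thesis by blast
  qed
  have "\<exists>c. p * z * p = c \<cdot>\<^sub>m p" if z: "z \<in> S" for z
  proof -
    define y where "y = p * z * p"
    have yS: "y \<in> S" unfolding y_def using z pS by (intro mem_closed)
    have yC: "y \<in> carrier_mat N N" "mat_adjoint y \<in> carrier_mat N N" using yS C by auto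
    have zC: "z \<in> carrier_mat N N" "mat_adjoint z \<in> carrier_mat N N" using z C by auto
    have ppx: "p * (p * u) = p * u" if "u \<in> carrier_mat N N" for u
      using square_mult_assoc[OF pC pC that] pp by simp
    have py: "p * y = y" "y * p = y"
      unfolding y_def using pC zC by (auto simp: square_mult_simps[where N = N] ppx pp)
    have y_adj: "mat_adjoint y = p * mat_adjoint z * p"
      unfolding y_def using pC zC
      by (simp add: mat_adjoint_mult[of _ N N _ N] p_adj square_mult_assoc[where N = N])
    have pya: "p * mat_adjoint y = mat_adjoint y" "mat_adjoint y * p = mat_adjoint y"
      unfolding y_adj using pC zC by (auto simp: square_mult_simps[where N = N] ppx pp)
    \<comment> \<open>A general element of the corner is split into hermitian parts: with
      \<open>y + mat_adjoint y = a p\<close> and \<open>\<i> (y - mat_adjoint y) = b p\<close>,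
      subtracting \<i> times the second from the first gives 2 y.\<close>
    have "\<exists>c. y + mat_adjoint y = c \<cdot>\<^sub>m p"
    proof (rule herm)
      show "mat_adjoint (y + mat_adjoint y) = y + mat_adjoint y"
        unfolding mat_adjoint_add[OF yC] mat_adjoint_adjoint
        by (rule comm_add_mat[OF yC(2,1)])
      show "p * (y + mat_adjoint y) = y + mat_adjoint y"
        unfolding mult_add_distrib_mat[OF pC yC] py pya by (rule refl)
      show "(y + mat_adjoint y) * p = y + mat_adjoint y"
        unfolding add_mult_distrib_mat[OF yC pC] py pya by (rule refl)
    qed (use yS in \<open>intro mem_closed\<close>)
    then obtain a where a: "y + mat_adjoint y = a \<cdot>\<^sub>m p" by blast
    have iy: "\<i> \<cdot>\<^sub>m y \<in> carrier_mat N N" "(- \<i>) \<cdot>\<^sub>m mat_adjoint y \<in> carrier_mat N N"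
      using yC by (auto simp only: smult_carrier_mat)
    have "\<exists>c. \<i> \<cdot>\<^sub>m y + (- \<i>) \<cdot>\<^sub>m mat_adjoint y = c \<cdot>\<^sub>m p"
    proof (rule herm)
      show "mat_adjoint (\<i> \<cdot>\<^sub>m y + (- \<i>) \<cdot>\<^sub>m mat_adjoint y) = \<i> \<cdot>\<^sub>m y + (- \<i>) \<cdot>\<^sub>m mat_adjoint y"
        unfolding mat_adjoint_add[OF iy] mat_adjoint_smult mat_adjoint_adjoint
        by (subst comm_add_mat[of _ N N]) (use iy in auto)
      show "p * (\<i> \<cdot>\<^sub>m y + (- \<i>) \<cdot>\<^sub>m mat_adjoint y) = \<i> \<cdot>\<^sub>m y + (- \<i>) \<cdot>\<^sub>m mat_adjoint y"
        unfolding mult_add_distrib_mat[OF pC iy] mult_smult_distrib[OF pC yC(1)] mult_smult_distrib[OF pC yC(2)] py pya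
        by (rule refl)
      show "(\<i> \<cdot>\<^sub>m y + (- \<i>) \<cdot>\<^sub>m mat_adjoint y) * p = \<i> \<cdot>\<^sub>m y + (- \<i>) \<cdot>\<^sub>m mat_adjoint y"
        unfolding add_mult_distrib_mat[OF iy pC] mult_smult_assoc_mat[OF yC(1) pC] mult_smult_assoc_mat[OF yC(2) pC] py pya
        by (rule refl)
    qed (use yS in \<open>intro mem_closed\<close>)
    then obtain b where b: "\<i> \<cdot>\<^sub>m y + (- \<i>) \<cdot>\<^sub>m mat_adjoint y = b \<cdot>\<^sub>m p" by blast
    have "y = ((a - \<i> * b) / 2) \<cdot>\<^sub>m p"
    proof (rule eq_matI)
      fix i j assume "i < dim_row (((a - \<i> * b) / 2) \<cdot>\<^sub>m p)" "j < dim_col (((a - \<i> * b) / 2) \<cdot>\<^sub>m p)"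
      then have ij: "i < N" "j < N" using pC by auto
      have "(y + mat_adjoint y) $$ (i, j) = (a \<cdot>\<^sub>m p) $$ (i, j)" using a by simp
      then have 1: "y $$ (i, j) + mat_adjoint y $$ (i, j) = a * p $$ (i, j)"
        using ij yC pC by simp
      have "(\<i> \<cdot>\<^sub>m y + (- \<i>) \<cdot>\<^sub>m mat_adjoint y) $$ (i, j) = (b \<cdot>\<^sub>m p) $$ (i, j)" using b by simp
      then have 2: "\<i> * y $$ (i, j) - \<i> * mat_adjoint y $$ (i, j) = b * p $$ (i, j)"
        using ij yC pC by simp
      have "(a - \<i> * b) * p $$ (i, j) = a * p $$ (i, j) - \<i> * (b * p $$ (i, j))"
        by (simp add: algebra_simps)
      also have "\<dots> = 2 * y $$ (i, j)" unfolding 1[symmetric] 2[symmetric]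
        by (simp add: algebra_simps)
      finally show "y $$ (i, j) = (((a - \<i> * b) / 2) \<cdot>\<^sub>m p) $$ (i, j)"
        using ij pC by simp
    qed (use pC yC in auto)
    then show ?thesis unfolding y_def by blast
  qed
  then have "minimal_projection N S p"
    unfolding minimal_projection_def using pS p_nz pp p_adj by blast
  then show ?thesis by blast
qed

end

section \<open>Finite sums of matrices and families of orthogonal projections\<close>

lemma mat_adjoint_zero: "mat_adjoint (0\<^sub>m n m :: complex mat) = 0\<^sub>m m n"
  by (rule eq_matI) (simp_all add: mat_adjoint_index[OF zero_carrier_mat])

lemma mat_adjoint_eq_0_iff:
  fixes A :: "complex mat"
  shows "mat_adjoint A = 0\<^sub>m m n \<longleftrightarrow> A = 0\<^sub>m n m"
  using mat_adjoint_zero[of n m] mat_adjoint_zero[of m n] mat_adjoint_adjoint[of A] by metis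

lemma mat_trace_smult: "mat_trace (c \<cdot>\<^sub>m A) = c * mat_trace A" if "A \<in> carrier_mat n n"
  using that by (simp add: mat_trace_def sum_distrib_left)

text \<open>Matrices of all sizes share one type, so the zero matrix depends on the size. The size
  is therefore an argument and the sum is taken entrywise; the empty sum is then the zero matrix of
  that size.\<close>

definition big_sum_mat :: "nat \<Rightarrow> ('i \<Rightarrow> complex mat) \<Rightarrow> 'i set \<Rightarrow> complex mat" where
  "big_sum_mat N f I = mat N N (\<lambda>ij. \<Sum>k\<in>I. f k $$ ij)"

lemma big_sum_mat_carrier [simp]: "big_sum_mat N f I \<in> carrier_mat N N"
  and dim_big_sum_mat [simp]: "dim_row (big_sum_mat N f I) = N" "dim_col (big_sum_mat N f I) = N"
  by (simp_all add: big_sum_mat_def)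

lemma big_sum_mat_index: "i < N \<Longrightarrow> j < N \<Longrightarrow> big_sum_mat N f I $$ (i, j) = (\<Sum>k\<in>I. f k $$ (i, j))"
  by (simp add: big_sum_mat_def)

lemma big_sum_mat_cong: "(\<And>k. k \<in> I \<Longrightarrow> f k = g k) \<Longrightarrow> big_sum_mat N f I = big_sum_mat N g I"
  unfolding big_sum_mat_def by (intro cong_mat refl sum.cong) auto

lemma big_sum_mat_empty [simp]: "big_sum_mat N f {} = 0\<^sub>m N N"
  by (rule eq_matI) (simp_all add: big_sum_mat_index)

lemma big_sum_mat_insert:
  assumes "finite I" "k \<notin> I" "f k \<in> carrier_mat N N"
  shows "big_sum_mat N f (insert k I) = f k + big_sum_mat N f I"
  by (rule eq_matI) (use assms in \<open>simp_all add: big_sum_mat_index\<close>)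

lemma big_sum_mat_mono_neutral:
  assumes "finite I" "J \<subseteq> I" "\<And>k. k \<in> I - J \<Longrightarrow> f k = 0\<^sub>m N N"
  shows "big_sum_mat N f I = big_sum_mat N f J"
proof (rule eq_matI)
  fix i j assume "i < dim_row (big_sum_mat N f J)" "j < dim_col (big_sum_mat N f J)"
  then have ij: "i < N" "j < N" by simp_all
  show "big_sum_mat N f I $$ (i, j) = big_sum_mat N f J $$ (i, j)"
    unfolding big_sum_mat_index[OF ij]
    by (rule sum.mono_neutral_right) (use assms ij in auto)
qed simp_all

lemma big_sum_mat_single:
  assumes "finite I" "a \<in> I" "f a \<in> carrier_mat N N" "\<And>k. k \<in> I \<Longrightarrow> k \<noteq> a \<Longrightarrow> f k = 0\<^sub>m N N"
  shows "big_sum_mat N f I = f a"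
proof -
  have "big_sum_mat N f I = big_sum_mat N f {a}"
    by (rule big_sum_mat_mono_neutral) (use assms in auto)
  also have "\<dots> = f a" by (rule eq_matI) (use assms(3) in \<open>simp_all add: big_sum_mat_index\<close>)
  finally show ?thesis .
qed

lemma big_sum_mat_reindex:
  assumes "bij_betw h I J"
  shows "big_sum_mat N f J = big_sum_mat N (\<lambda>k. f (h k)) I"
  by (rule eq_matI) (simp_all add: big_sum_mat_index sum.reindex_bij_betw[OF assms, symmetric])

lemma big_sum_mat_nested:
  "big_sum_mat N (\<lambda>k. big_sum_mat N (f k) J) I = big_sum_mat N (\<lambda>(k, l). f k l) (I \<times> J)"
proof (rule eq_matI)
  fix i j assume "i < dim_row (big_sum_mat N (\<lambda>(k, l). f k l) (I \<times> J))"
    "j < dim_col (big_sum_mat N (\<lambda>(k, l). f k l) (I \<times> J))"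
  then have ij: "i < N" "j < N" by simp_all
  show "big_sum_mat N (\<lambda>k. big_sum_mat N (f k) J) I $$ (i, j) = big_sum_mat N (\<lambda>(k, l). f k l) (I \<times> J) $$ (i, j)"
    unfolding big_sum_mat_index[OF ij] sum.cartesian_product
    by (rule sum.cong) auto
qed simp_all

lemma mult_big_sum_mat:
  assumes A: "A \<in> carrier_mat N N" and f: "\<And>k. k \<in> I \<Longrightarrow> f k \<in> carrier_mat N N"
  shows "A * big_sum_mat N f I = big_sum_mat N (\<lambda>k. A * f k) I"
proof (rule eq_matI)
  fix i j assume "i < dim_row (big_sum_mat N (\<lambda>k. A * f k) I)" "j < dim_col (big_sum_mat N (\<lambda>k. A * f k) I)"
  then have ij: "i < N" "j < N" by simp_all
  have "(A * big_sum_mat N f I) $$ (i, j) = (\<Sum>l<N. \<Sum>k\<in>I. A $$ (i, l) * f k $$ (l, j))"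
    unfolding index_mult_mat_sum[OF A big_sum_mat_carrier ij]
    by (intro sum.cong) (simp_all add: big_sum_mat_index ij sum_distrib_left)
  also have "\<dots> = (\<Sum>k\<in>I. \<Sum>l<N. A $$ (i, l) * f k $$ (l, j))" by (rule sum.swap)
  also have "\<dots> = (\<Sum>k\<in>I. (A * f k) $$ (i, j))"
    by (intro sum.cong) (simp_all add: index_mult_mat_sum[OF A f ij] del: index_mult_mat)
  also have "\<dots> = big_sum_mat N (\<lambda>k. A * f k) I $$ (i, j)"
    by (simp only: big_sum_mat_index[OF ij])
  finally show "(A * big_sum_mat N f I) $$ (i, j) = big_sum_mat N (\<lambda>k. A * f k) I $$ (i, j)" .
qed (use A in simp_all)

lemma adjoint_big_sum_mat:
  assumes f: "\<And>k. k \<in> I \<Longrightarrow> f k \<in> carrier_mat N N"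
  shows "mat_adjoint (big_sum_mat N f I) = big_sum_mat N (\<lambda>k. mat_adjoint (f k)) I"
proof (rule eq_matI)
  fix i j assume "i < dim_row (big_sum_mat N (\<lambda>k. mat_adjoint (f k)) I)"
    "j < dim_col (big_sum_mat N (\<lambda>k. mat_adjoint (f k)) I)"
  then have ij: "i < N" "j < N" by simp_all
  show "mat_adjoint (big_sum_mat N f I) $$ (i, j) = big_sum_mat N (\<lambda>k. mat_adjoint (f k)) I $$ (i, j)"
    unfolding mat_adjoint_index[OF big_sum_mat_carrier ij] big_sum_mat_index[OF ij] big_sum_mat_index[OF ij(2,1)] cnj_sum
    by (intro sum.cong) (simp_all add: mat_adjoint_index[OF f ij])
qed simp_all

lemma big_sum_mat_mult:
  assumes A: "A \<in> carrier_mat N N" and f: "\<And>k. k \<in> I \<Longrightarrow> f k \<in> carrier_mat N N"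
  shows "big_sum_mat N f I * A = big_sum_mat N (\<lambda>k. f k * A) I"
proof (rule eq_matI)
  fix i j assume "i < dim_row (big_sum_mat N (\<lambda>k. f k * A) I)" "j < dim_col (big_sum_mat N (\<lambda>k. f k * A) I)"
  then have ij: "i < N" "j < N" by simp_all
  have "(big_sum_mat N f I * A) $$ (i, j) = (\<Sum>l<N. \<Sum>k\<in>I. f k $$ (i, l) * A $$ (l, j))"
    unfolding index_mult_mat_sum[OF big_sum_mat_carrier A ij]
    by (intro sum.cong) (simp_all add: big_sum_mat_index ij sum_distrib_right)
  also have "\<dots> = (\<Sum>k\<in>I. \<Sum>l<N. f k $$ (i, l) * A $$ (l, j))" by (rule sum.swap)
  also have "\<dots> = (\<Sum>k\<in>I. (f k * A) $$ (i, j))"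
    by (intro sum.cong) (simp_all add: index_mult_mat_sum[OF f A ij] del: index_mult_mat)
  also have "\<dots> = big_sum_mat N (\<lambda>k. f k * A) I $$ (i, j)"
    by (simp only: big_sum_mat_index[OF ij])
  finally show "(big_sum_mat N f I * A) $$ (i, j) = big_sum_mat N (\<lambda>k. f k * A) I $$ (i, j)" .
qed (use A in simp_all)

lemma add_smult_minus_one:
  fixes A :: "complex mat"
  assumes "A \<in> carrier_mat n m"
  shows "A + (- 1) \<cdot>\<^sub>m A = 0\<^sub>m n m"
  by (rule eq_matI) (use assms in simp_all)

lemma add_smult_zero:
  fixes A :: "complex mat"
  assumes "A \<in> carrier_mat n m"
  shows "A + c \<cdot>\<^sub>m 0\<^sub>m n m = A"
  by (rule eq_matI) (use assms in simp_all)

lemma (in matrix_star_algebra) big_sum_mat_mem: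
  assumes "finite I" "\<And>k. k \<in> I \<Longrightarrow> f k \<in> S"
  shows "big_sum_mat N f I \<in> S"
  using assms
proof (induction I rule: finite_induct)
  case empty
  show ?case unfolding big_sum_mat_empty by (rule mem_zero)
next
  case (insert k I)
  have "big_sum_mat N f (insert k I) = f k + big_sum_mat N f I"
    using insert.hyps mem_carrier[OF insert.prems] by (intro big_sum_mat_insert) auto
  then show ?case using insert by (simp add: mem_add)
qed

text \<open>Each further idempotent strictly shrinks the kernel of the sum. If (p + A) v = 0,
  applying \<open>p\<close> gives p v = 0 and so A v = 0; conversely a nonzero p w is killed by
  \<open>A\<close> but fixed by p + A. The kernel dimension stands in the statement to carry the
  induction.\<close>

lemma card_orthogonal_idempotents_le:
  fixes R :: "complex mat set"
  assumes "finite R" "\<And>p. p \<in> R \<Longrightarrow> p \<in> carrier_mat N N" "\<And>p. p \<in> R \<Longrightarrow> p \<noteq> 0\<^sub>m N N"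
    "\<And>p. p \<in> R \<Longrightarrow> p * p = p" "\<And>p q. p \<in> R \<Longrightarrow> q \<in> R \<Longrightarrow> p \<noteq> q \<Longrightarrow> p * q = 0\<^sub>m N N"
  shows "kernel_dim (big_sum_mat N (\<lambda>p. p) R) + card R \<le> N"
  using assms
proof (induction R rule: finite_induct)
  case empty
  show ?case using kernel_dim_le[OF zero_carrier_mat[of N N]] by simp
next
  case (insert p R)
  let ?A = "big_sum_mat N (\<lambda>p. p) R" and ?B = "big_sum_mat N (\<lambda>p. p) (insert p R)"
  have pC: "p \<in> carrier_mat N N" by (rule insert.prems(1)) simp
  have B: "?B = p + ?A" using insert.hyps pC by (intro big_sum_mat_insert)
  have IH: "kernel_dim ?A + card R \<le> N" using insert.prems by (intro insert.IH) auto
  have pq: "p * q = 0\<^sub>m N N" "q * p = 0\<^sub>m N N" if "q \<in> R" for q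
    using that insert.prems(4)[of p q] insert.prems(4)[of q p] insert.hyps(2) by auto
  have RC: "q \<in> carrier_mat N N" if "q \<in> R" for q using that insert.prems(1) by simp
  have "p * ?A = big_sum_mat N (\<lambda>q. p * q) R" by (rule mult_big_sum_mat[OF pC]) (rule RC)
  also have "\<dots> = big_sum_mat N (\<lambda>q. p * q) {}"
    by (rule big_sum_mat_mono_neutral[OF insert.hyps(1)]) (use pq in auto)
  finally have pA: "p * ?A = 0\<^sub>m N N" by simp
  have "?A * p = big_sum_mat N (\<lambda>q. q * p) R" by (rule big_sum_mat_mult[OF pC]) (rule RC)
  also have "\<dots> = big_sum_mat N (\<lambda>q. q * p) {}"
    by (rule big_sum_mat_mono_neutral[OF insert.hyps(1)]) (use pq in auto)
  finally have Ap: "?A * p = 0\<^sub>m N N" by simp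
  have pp: "p * p = p" by (rule insert.prems(3)) simp
  have Bv: "?B *\<^sub>v v = p *\<^sub>v v + ?A *\<^sub>v v" if "v \<in> carrier_vec N" for v
    unfolding B by (rule add_mult_distrib_mat_vec[OF pC big_sum_mat_carrier that])
  have zero: "0\<^sub>m N N *\<^sub>v v = 0\<^sub>v N" if "v \<in> carrier_vec N" for v :: "complex vec"
    using that by (intro eq_vecI) (auto simp: scalar_prod_def)
  have "\<exists>w\<in>carrier_vec N. p *\<^sub>v w \<noteq> 0\<^sub>v N"
  proof (rule ccontr)
    assume neg: "\<not> ?thesis"
    have "p = 0\<^sub>m N N"
    proof (rule eq_matI)
      fix i j assume "i < dim_row (0\<^sub>m N N :: complex mat)" "j < dim_col (0\<^sub>m N N :: complex mat)"
      then have ij: "i < N" "j < N" by simp_all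
      have "p *\<^sub>v unit_vec N j = 0\<^sub>v N" using neg by simp
      then have "(p *\<^sub>v unit_vec N j) $ i = 0" using ij by simp
      then show "p $$ (i, j) = 0\<^sub>m N N $$ (i, j)" using ij pC by simp
    qed (use pC in auto)
    then show False using insert.prems(2)[of p] by simp
  qed
  then obtain w where w: "w \<in> carrier_vec N" "p *\<^sub>v w \<noteq> 0\<^sub>v N" by blast
  have pw: "p *\<^sub>v w \<in> carrier_vec N" using pC w(1) by simp
  have "mat_kernel ?B \<subseteq> mat_kernel ?A"
  proof
    fix v assume "v \<in> mat_kernel ?B"
    then have v: "v \<in> carrier_vec N" "?B *\<^sub>v v = 0\<^sub>v N"
      by (auto simp: mem_mat_kernel_iff[OF big_sum_mat_carrier])
    have "p *\<^sub>v (?B *\<^sub>v v) = p *\<^sub>v (p *\<^sub>v v) + p *\<^sub>v (?A *\<^sub>v v)"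
      unfolding Bv[OF v(1)] using pC v(1)
      by (intro mult_add_distrib_mat_vec[of _ N N] mult_mat_vec_carrier[of _ N N] big_sum_mat_carrier)
    also have "\<dots> = p *\<^sub>v v + 0\<^sub>v N"
      unfolding assoc_mult_mat_vec[OF pC pC v(1), symmetric] pp
        assoc_mult_mat_vec[OF pC big_sum_mat_carrier v(1), symmetric] pA zero[OF v(1)] by (rule refl)
    finally have "p *\<^sub>v v = 0\<^sub>v N"
      unfolding v(2) mult_mat_zero_vec[OF pC] using pC v(1) by simp
    then have "?A *\<^sub>v v = 0\<^sub>v N"
      using v(2) unfolding Bv[OF v(1)]
      by (simp add: left_zero_vec[OF mult_mat_vec_carrier[OF big_sum_mat_carrier v(1)]])
    then show "v \<in> mat_kernel ?A" using v(1) by (simp add: mem_mat_kernel_iff[OF big_sum_mat_carrier])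
  qed
  moreover have "p *\<^sub>v w \<in> mat_kernel ?A"
    unfolding mem_mat_kernel_iff[OF big_sum_mat_carrier] assoc_mult_mat_vec[OF big_sum_mat_carrier pC w(1), symmetric] Ap
    using zero[OF w(1)] pw by simp
  moreover have "p *\<^sub>v w \<notin> mat_kernel ?B"
  proof -
    have "?B *\<^sub>v (p *\<^sub>v w) = p *\<^sub>v w + 0\<^sub>v N"
      unfolding Bv[OF pw]
      unfolding assoc_mult_mat_vec[OF big_sum_mat_carrier pC w(1), symmetric] Ap zero[OF w(1)]
        assoc_mult_mat_vec[OF pC pC w(1), symmetric] pp by (rule refl)
    then show ?thesis using w(2) pw by (simp add: mem_mat_kernel_iff[OF big_sum_mat_carrier])
  qed
  ultimately have "mat_kernel ?B \<subset> mat_kernel ?A" by blast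
  then have "kernel_dim ?B < kernel_dim ?A"
    by (rule kernel_dim_less[OF big_sum_mat_carrier big_sum_mat_carrier])
  then show ?case using IH insert.hyps by simp
qed

definition orthogonal_minimal_family :: "nat \<Rightarrow> complex mat set \<Rightarrow> complex mat set \<Rightarrow> bool" where
  "orthogonal_minimal_family N S R \<longleftrightarrow> finite R \<and> (\<forall>p\<in>R. minimal_projection N S p) \<and>
     (\<forall>p\<in>R. \<forall>q\<in>R. p \<noteq> q \<longrightarrow> p * q = 0\<^sub>m N N)"

context matrix_star_algebra
begin

lemma minimal_projectionD:
  assumes "minimal_projection N S p"
  shows "p \<in> S" "p \<in> carrier_mat N N" "p \<noteq> 0\<^sub>m N N" "p * p = p" "mat_adjoint p = p"
    "x \<in> S \<Longrightarrow> \<exists>c. p * x * p = c \<cdot>\<^sub>m p"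
  using assms mem_carrier unfolding minimal_projection_def by auto

lemma card_orthogonal_minimal_family_le:
  assumes "orthogonal_minimal_family N S R"
  shows "card R \<le> N"
proof -
  have R: "minimal_projection N S p" if "p \<in> R" for p
    using that assms unfolding orthogonal_minimal_family_def by blast
  have "kernel_dim (big_sum_mat N (\<lambda>p. p) R) + card R \<le> N"
  proof (rule card_orthogonal_idempotents_le)
    show "finite R" using assms unfolding orthogonal_minimal_family_def by blast
    show "p * q = 0\<^sub>m N N" if "p \<in> R" "q \<in> R" "p \<noteq> q" for p q
      using that assms unfolding orthogonal_minimal_family_def by blast
  qed (use minimal_projectionD[OF R] in auto)
  then show ?thesis by simp
qed

text \<open>If a family of maximal size had a sum \<open>Q\<close> different from the unit \<open>P\<close>, the corner of \<open>S\<close> at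
  \<open>D = P - Q\<close> would contain a further minimal projection.\<close>

lemma ex_complete_family:
  assumes P: "P \<in> S" "\<And>x. x \<in> S \<Longrightarrow> P * x = x" "\<And>x. x \<in> S \<Longrightarrow> x * P = x"
  shows "\<exists>R. orthogonal_minimal_family N S R \<and> big_sum_mat N (\<lambda>p. p) R = P"
proof -
  have "orthogonal_minimal_family N S {}" by (simp add: orthogonal_minimal_family_def)
  moreover have "\<forall>R. orthogonal_minimal_family N S R \<longrightarrow> card R < Suc N"
    using card_orthogonal_minimal_family_le by (simp add: less_Suc_eq_le)
  ultimately have "\<exists>R. orthogonal_minimal_family N S R \<and>
      (\<forall>R'. orthogonal_minimal_family N S R' \<longrightarrow> card R' \<le> card R)"
    by (rule ex_has_greatest_nat)
  then obtain R where R: "orthogonal_minimal_family N S R"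
    and max: "\<And>R'. orthogonal_minimal_family N S R' \<Longrightarrow> card R' \<le> card R" by auto
  have fin: "finite R" and orth: "\<And>p q. p \<in> R \<Longrightarrow> q \<in> R \<Longrightarrow> p \<noteq> q \<Longrightarrow> p * q = 0\<^sub>m N N"
    and Rmin: "\<And>p. p \<in> R \<Longrightarrow> minimal_projection N S p"
    using R by (auto simp: orthogonal_minimal_family_def)
  note Rp = minimal_projectionD[OF Rmin]
  define Q where "Q = big_sum_mat N (\<lambda>p. p) R"
  have QS: "Q \<in> S" unfolding Q_def using fin Rp(1) by (rule big_sum_mat_mem)
  have PC: "P \<in> carrier_mat N N" and QC: "Q \<in> carrier_mat N N" using P(1) QS by (simp_all add: mem_carrier)
  have Qp: "Q * p = p" if "p \<in> R" for p
  proof -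
    have "Q * p = big_sum_mat N (\<lambda>r. r * p) R" unfolding Q_def using Rp(2) that by (intro big_sum_mat_mult)
    also have "\<dots> = p * p" using Rp(2) that orth by (intro big_sum_mat_single[OF fin] mult_carrier_mat[of _ N N]) auto
    finally show ?thesis using Rp(4)[OF that] by simp
  qed
  have pQ: "p * Q = p" if "p \<in> R" for p
  proof -
    have "p * Q = big_sum_mat N (\<lambda>r. p * r) R" unfolding Q_def using Rp(2) that by (intro mult_big_sum_mat)
    also have "\<dots> = p * p" using Rp(2) that orth by (intro big_sum_mat_single[OF fin] mult_carrier_mat[of _ N N]) auto
    finally show ?thesis using Rp(4)[OF that] by simp
  qed
  have QQ: "Q * Q = Q"
  proof -
    have "Q * Q = big_sum_mat N (\<lambda>r. Q * r) R" by (subst (2) Q_def) (rule mult_big_sum_mat[OF QC Rp(2)])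
    also have "\<dots> = Q" unfolding Q_def using Qp by (intro big_sum_mat_cong) (simp add: Q_def)
    finally show ?thesis .
  qed
  have Q_adj: "mat_adjoint Q = Q"
  proof -
    have "mat_adjoint Q = big_sum_mat N (\<lambda>r. mat_adjoint r) R" unfolding Q_def using Rp(2) by (rule adjoint_big_sum_mat)
    also have "\<dots> = Q" unfolding Q_def using Rp(5) by (intro big_sum_mat_cong)
    finally show ?thesis .
  qed
  \<comment> \<open>The unit is only given algebraically. That it is hermitian follows because
    \<open>P * mat_adjoint P\<close> is hermitian and equals \<open>mat_adjoint P\<close>, as
    \<open>P\<close> is a left unit.\<close>
  have P_adj: "mat_adjoint P = P"
  proof -
    have "mat_adjoint (P * mat_adjoint P) = P * mat_adjoint P"
      unfolding mat_adjoint_mult[OF PC mat_adjoint_carrier[OF PC]] mat_adjoint_adjoint by (rule refl)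
    then show ?thesis unfolding P(2)[OF mem_adjoint[OF P(1)]] mat_adjoint_adjoint by (rule sym)
  qed
  have "Q = P"
  proof (rule ccontr)
    assume "Q \<noteq> P"
    define D where "D = P + (- 1) \<cdot>\<^sub>m Q"
    have DS: "D \<in> S" unfolding D_def using P(1) QS by (intro mem_add mem_smult)
    then have DC: "D \<in> carrier_mat N N" by (rule mem_carrier)
    have mQ: "(- 1) \<cdot>\<^sub>m Q \<in> carrier_mat N N" using QC by (rule smult_carrier_mat)
    have D_nz: "D \<noteq> 0\<^sub>m N N"
    proof
      assume "D = 0\<^sub>m N N"
      then have "P = 1 \<cdot>\<^sub>m Q" unfolding D_def by (rule add_smult_uminus_eq_0[OF PC QC])
      then show False using \<open>Q \<noteq> P\<close> by simp
    qed
    have Dx: "D * x = P * x + (- 1) \<cdot>\<^sub>m (Q * x)" if "x \<in> carrier_mat N N" for x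
      unfolding D_def add_mult_distrib_mat[OF PC mQ that] mult_smult_assoc_mat[OF QC that] by (rule refl)
    have xD: "x * D = x * P + (- 1) \<cdot>\<^sub>m (x * Q)" if "x \<in> carrier_mat N N" for x
      unfolding D_def mult_add_distrib_mat[OF that PC mQ] mult_smult_distrib[OF that QC] by (rule refl)
    have Dp: "D * p = 0\<^sub>m N N" and pD: "p * D = 0\<^sub>m N N" if "p \<in> R" for p
      unfolding Dx[OF Rp(2)[OF that]] xD[OF Rp(2)[OF that]] Qp[OF that] pQ[OF that] P(2)[OF Rp(1)[OF that]] P(3)[OF Rp(1)[OF that]]
      by (rule add_smult_minus_one[OF Rp(2)[OF that]])+
    have QD: "Q * D = 0\<^sub>m N N"
      unfolding xD[OF QC] QQ P(3)[OF QS] by (rule add_smult_minus_one[OF QC])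
    have DD: "D * D = D"
      unfolding Dx[OF DC] QD P(2)[OF DS] by (rule add_smult_zero[OF DC])
    have DDx: "D * (D * x) = D * x" if "x \<in> carrier_mat N N" for x
      using square_mult_assoc[OF DC DC that] DD by simp
    have D_adj: "mat_adjoint D = D"
      unfolding D_def mat_adjoint_add[OF PC mQ] mat_adjoint_smult P_adj Q_adj by simp
    \<comment> \<open>The corner is a star subalgebra in its own right and contains D = D D D, which
      is nonzero, so the existence of minimal projections applies to it.\<close>
    define T where "T = (\<lambda>x. D * x * D) ` S"
    note sq = square_mult_simps[where N = N]
    have TS: "T \<subseteq> S" unfolding T_def using DS by (auto intro: mem_mult)
    have "star_subalgebra T (mat_star_algebra N)"
    proof -
      have "0\<^sub>m N N \<in> T"
      proof -
        have "0\<^sub>m N N = D * 0\<^sub>m N N * D"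
          unfolding right_mult_zero_mat[OF DC] left_mult_zero_mat[OF DC] by (rule refl)
        then show ?thesis unfolding T_def using mem_zero by (rule image_eqI)
      qed
      moreover have "D * x * D + D * y * D \<in> T" if "x \<in> S" "y \<in> S" for x y
      proof -
        note xy = that[THEN mem_carrier]
        have "D * x * D + D * y * D = D * (x + y) * D"
          unfolding mult_add_distrib_mat[OF DC xy]
            add_mult_distrib_mat[OF mult_carrier_mat[OF DC xy(1)] mult_carrier_mat[OF DC xy(2)] DC]
          by (rule refl)
        then show ?thesis unfolding T_def using mem_add[OF that] by (rule image_eqI)
      qed
      moreover have "c \<cdot>\<^sub>m (D * x * D) \<in> T" if "x \<in> S" for c x
      proof -
        note xC = that[THEN mem_carrier]
        have "c \<cdot>\<^sub>m (D * x * D) = D * (c \<cdot>\<^sub>m x) * D"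
          unfolding mult_smult_distrib[OF DC xC] mult_smult_assoc_mat[OF mult_carrier_mat[OF DC xC] DC]
          by (rule refl)
        then show ?thesis unfolding T_def using mem_smult[OF that] by (rule image_eqI)
      qed
      moreover have "(D * x * D) * (D * y * D) \<in> T" if "x \<in> S" "y \<in> S" for x y
      proof -
        have "(D * x * D) * (D * y * D) = D * (x * (D * y)) * D"
          using DC that[THEN mem_carrier] by (simp add: sq DDx)
        then show ?thesis unfolding T_def using mem_mult[OF that(1) mem_mult[OF DS that(2)]] by (rule image_eqI)
      qed
      moreover have "mat_adjoint (D * x * D) \<in> T" if "x \<in> S" for x
      proof -
        note xC = that[THEN mem_carrier]
        have "mat_adjoint (D * x * D) = D * (mat_adjoint x * D)"
          unfolding mat_adjoint_mult[OF mult_carrier_mat[OF DC xC] DC] mat_adjoint_mult[OF DC xC] D_adj by (rule refl)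
        then have "mat_adjoint (D * x * D) = D * mat_adjoint x * D"
          using square_mult_assoc[OF DC mat_adjoint_carrier[OF xC] DC] by simp
        then show ?thesis unfolding T_def using mem_adjoint[OF that] by (rule image_eqI)
      qed
      moreover have "T \<subseteq> carrier_mat N N" using TS mem_carrier by blast
      ultimately show ?thesis
        unfolding star_subalgebra_def mat_star_algebra_def by (auto simp: T_def)
    qed
    then interpret T: matrix_star_algebra N T by unfold_locales
    have "D * D * D \<in> T" unfolding T_def using DS by blast
    then have "T \<noteq> {0\<^sub>m N N}" using D_nz DD by auto
    then obtain q where q: "minimal_projection N T q" using T.ex_minimal_projection by blast
    note qD = T.minimal_projectionD[OF q]
    obtain z where z: "z \<in> S" "q = D * z * D" using qD(1) unfolding T_def by blast
    have Dq: "D * q = q" "q * D = q"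
      unfolding z(2) using DC mem_carrier[OF z(1)] by (simp_all add: sq DDx DD)
    have qp: "q * p = 0\<^sub>m N N" and pq: "p * q = 0\<^sub>m N N" if "p \<in> R" for p
    proof -
      have "q * p = q * (D * p)" using square_mult_assoc[OF qD(2) DC Rp(2)[OF that]] Dq by simp
      then show "q * p = 0\<^sub>m N N" unfolding Dp[OF that] right_mult_zero_mat[OF qD(2)] .
      have "p * q = (p * D) * q" using square_mult_assoc[OF Rp(2)[OF that] DC qD(2)] Dq by simp
      then show "p * q = 0\<^sub>m N N" unfolding pD[OF that] left_mult_zero_mat[OF qD(2)] .
    qed
    have "minimal_projection N S q"
      unfolding minimal_projection_def
    proof (intro conjI ballI)
      fix y assume y: "y \<in> S"
      note yC = mem_carrier[OF y]
      have qDx: "q * (D * x) = q * x" if "x \<in> carrier_mat N N" for x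
        using square_mult_assoc[OF qD(2) DC that] Dq by simp
      \<comment> \<open>As \<open>q\<close> absorbs \<open>D\<close> on both sides, its corner in
        \<open>S\<close> coincides with its corner in \<open>T\<close>; minimality in
        \<open>T\<close> thus implies minimality in \<open>S\<close>.\<close>
      have "q * (D * y * D) * q = q * y * q"
        using qD(2) DC yC by (simp add: sq qDx Dq)
      moreover have "D * y * D \<in> T" unfolding T_def using y by blast
      ultimately show "\<exists>c. q * y * q = c \<cdot>\<^sub>m q" using qD(6)[of "D * y * D"] by simp
    qed (use qD TS in auto)
    moreover have "q \<notin> R" using qp qD(3,4) by auto
    ultimately have "orthogonal_minimal_family N S (insert q R)"
      using fin Rmin orth qp pq by (auto simp: orthogonal_minimal_family_def)
    then have "card (insert q R) \<le> card R" by (rule max)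
    then show False using fin \<open>q \<notin> R\<close> by simp
  qed
  then show ?thesis using R Q_def by blast
qed

end

section \<open>Matrix units\<close>

text \<open>The relation \<open>E\<close> encodes a direct sum of full matrix algebras: one block
  for each class, with a unit for each pair inside a block. Values of \<open>e\<close> off
  \<open>E\<close> are irrelevant, and transitivity keeps the index of a nonzero product in
  \<open>E\<close>.\<close>

definition matrix_units :: "nat \<Rightarrow> 'i set \<Rightarrow> ('i \<times> 'i) set \<Rightarrow> ('i \<times> 'i \<Rightarrow> complex mat) \<Rightarrow> bool" where
  "matrix_units N I E e \<longleftrightarrow> finite I \<and> equiv I E \<and>
     (\<forall>a\<in>E. e a \<in> carrier_mat N N \<and> e a \<noteq> 0\<^sub>m N N \<and> mat_adjoint (e a) = e (prod.swap a)) \<and>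
     (\<forall>a\<in>E. \<forall>b\<in>E. e a * e b = (if snd a = fst b then e (fst a, snd b) else 0\<^sub>m N N))"

definition unit_combination ::
  "nat \<Rightarrow> ('i \<times> 'i) set \<Rightarrow> ('i \<times> 'i \<Rightarrow> complex mat) \<Rightarrow> ('i \<times> 'i \<Rightarrow> complex) \<Rightarrow> complex mat" where
  "unit_combination N E e c = big_sum_mat N (\<lambda>a. c a \<cdot>\<^sub>m e a) E"

section \<open>Matrix units from a complete family of minimal projections\<close>

locale complete_minimal_family = matrix_star_algebra +
  fixes R :: "complex mat set"
  assumes family: "orthogonal_minimal_family N S R"
    and complete_left: "x \<in> S \<Longrightarrow> big_sum_mat N (\<lambda>p. p) R * x = x"
    and complete_right: "x \<in> S \<Longrightarrow> x * big_sum_mat N (\<lambda>p. p) R = x"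
begin

lemma finite_family: "finite R"
  and orthogonal: "p \<in> R \<Longrightarrow> q \<in> R \<Longrightarrow> p \<noteq> q \<Longrightarrow> p * q = 0\<^sub>m N N"
  and minimal: "p \<in> R \<Longrightarrow> minimal_projection N S p"
  using family by (auto simp: orthogonal_minimal_family_def)

lemmas projD = minimal_projectionD[OF minimal]

definition linked :: "(complex mat \<times> complex mat) set" where
  "linked = {(p, q). p \<in> R \<and> q \<in> R \<and> (\<exists>x\<in>S. p * x * q \<noteq> 0\<^sub>m N N)}"

definition is_link :: "complex mat \<Rightarrow> complex mat \<Rightarrow> complex mat \<Rightarrow> bool" where
  "is_link p q u \<longleftrightarrow> u \<in> S \<and> mat_adjoint u * u = q \<and> u * mat_adjoint u = p \<and> p * u = u \<and> u * q = u"

text \<open>For \<open>w = p x q \<noteq> 0\<close>, both \<open>w\<^sup>* w\<close> and \<open>w w\<^sup>*\<close> are the same positive multiple of \<open>q\<close> and \<open>p\<close>,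
  respectively, so that \<open>w\<close> can be normalized to a partial isometry.\<close>

lemma ex_link:
  assumes "(p, q) \<in> linked"
  shows "\<exists>u. is_link p q u"
proof -
  obtain x where R: "p \<in> R" "q \<in> R" and x: "x \<in> S" "p * x * q \<noteq> 0\<^sub>m N N"
    using assms unfolding linked_def by blast
  note p = projD[OF R(1)] and q = projD[OF R(2)]
  note xC = mem_carrier[OF x(1)]
  note sq = square_mult_simps[where N = N]
  define w where "w = p * x * q"
  have wS: "w \<in> S" unfolding w_def using p(1) q(1) x(1) by (intro mem_mult)
  then have wC: "w \<in> carrier_mat N N" by (rule mem_carrier)
  note wC' = mat_adjoint_carrier[OF wC]
  have w_nz: "w \<noteq> 0\<^sub>m N N" using x(2) by (simp add: w_def)
  have ppy: "p * (p * y) = p * y" if "y \<in> carrier_mat N N" for y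
    using square_mult_assoc[OF p(2) p(2) that] p(4) by simp
  have qqy: "q * (q * y) = q * y" if "y \<in> carrier_mat N N" for y
    using square_mult_assoc[OF q(2) q(2) that] q(4) by simp
  have pw: "p * w = w" unfolding w_def using p(2) q(2) xC by (simp add: sq ppy)
  have wq: "w * q = w" unfolding w_def using p(2) q(2) xC by (simp add: sq q(4))
  have w_adj: "mat_adjoint w = q * (mat_adjoint x * p)"
    unfolding w_def mat_adjoint_mult[OF mult_carrier_mat[OF p(2) xC] q(2)] mat_adjoint_mult[OF p(2) xC] p(5) q(5)
    by (rule refl)
  have "mat_adjoint w * w = q * (mat_adjoint x * p * x) * q"
    unfolding w_adj unfolding w_def using p(2) q(2) xC mat_adjoint_carrier[OF xC]
    by (simp add: sq ppy)
  moreover have "mat_adjoint x * p * x \<in> S" using x(1) p(1) by (intro mem_mult mem_adjoint)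
  ultimately obtain c where c: "mat_adjoint w * w = c \<cdot>\<^sub>m q" using q(6) by metis
  have "w * mat_adjoint w = p * (x * q * mat_adjoint x) * p"
    unfolding w_adj unfolding w_def using p(2) q(2) xC mat_adjoint_carrier[OF xC]
    by (simp add: sq qqy)
  moreover have "x * q * mat_adjoint x \<in> S" using x(1) q(1) by (intro mem_mult mem_adjoint)
  ultimately obtain d where d: "w * mat_adjoint w = d \<cdot>\<^sub>m p" using p(6) by metis
  \<comment> \<open>Taking traces shows that the scalar \<open>c\<close> is a quotient of two
    positive reals; this is what permits the square root in the normalisation.\<close>
  obtain s where s: "s > 0" "mat_trace (mat_adjoint w * w) = of_real s"
    using mat_trace_adjoint_mult_pos[OF wC w_nz] by blast
  obtain t where t: "t > 0" "mat_trace (mat_adjoint q * q) = of_real t"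
    using mat_trace_adjoint_mult_pos[OF q(2,3)] by blast
  define r where "r = s / t"
  have r: "r > 0" using s t by (simp add: r_def)
  have "c * of_real t = of_real s"
    using s(2) t(2) unfolding c q(5) q(4) mat_trace_smult[OF q(2)] by simp
  then have cr: "c = of_real r" using t(1) by (simp add: r_def field_simps)
  \<comment> \<open>The square of \<open>w * mat_adjoint w\<close> is d^2 p, and evaluated through
    its inner factor \<open>mat_adjoint w * w\<close> it is c d p.\<close>
  have "d = c"
  proof -
    have ww_nz: "w * mat_adjoint w \<noteq> 0\<^sub>m N N"
      using adjoint_mult_eq_0_iff[OF wC'] w_nz mat_adjoint_eq_0_iff[of w N N]
      unfolding mat_adjoint_adjoint by blast
    then have "d \<noteq> 0" using d p(2) by (auto intro!: eq_matI)
    have "(w * mat_adjoint w) * (w * mat_adjoint w) = w * ((mat_adjoint w * w) * mat_adjoint w)"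
      using wC wC' by (simp add: sq)
    also have "\<dots> = c \<cdot>\<^sub>m (w * (q * mat_adjoint w))"
      unfolding c mult_smult_assoc_mat[OF q(2) wC'] mult_smult_distrib[OF wC mult_carrier_mat[OF q(2) wC']]
      by (rule refl)
    also have "w * (q * mat_adjoint w) = w * mat_adjoint w"
      using square_mult_assoc[OF wC q(2) wC'] wq by simp
    finally have "(d * d) \<cdot>\<^sub>m p = (c * d) \<cdot>\<^sub>m p"
      unfolding d mult_smult_assoc_mat[OF p(2) smult_carrier_mat[OF p(2)]] mult_smult_distrib[OF p(2,2)] p(4) smult_smult_mat .
    then have "d * d = c * d" by (rule smult_mat_cancel[OF p(2,3)])
    then show ?thesis using \<open>d \<noteq> 0\<close> by simp
  qed
  define k where "k = complex_of_real (1 / sqrt r)"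
  have k: "cnj k = k" by (simp add: k_def)
  have "sqrt r * sqrt r = r" using r by simp
  then have "(1 / sqrt r) * (1 / sqrt r) * r = 1" using r by simp
  then have "complex_of_real ((1 / sqrt r) * (1 / sqrt r) * r) = 1" by simp
  then have kk: "k * k * c = 1" unfolding k_def cr of_real_mult .
  define u where "u = k \<cdot>\<^sub>m w"
  have u_adj: "mat_adjoint u = k \<cdot>\<^sub>m mat_adjoint w" by (simp add: u_def mat_adjoint_smult k)
  have "mat_adjoint u * u = (k * k * c) \<cdot>\<^sub>m q"
    unfolding u_adj unfolding u_def mult_smult_assoc_mat[OF wC' smult_carrier_mat[OF wC]] mult_smult_distrib[OF wC' wC] c
      smult_smult_mat by (simp add: mult.assoc)
  moreover have "u * mat_adjoint u = (k * k * c) \<cdot>\<^sub>m p"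
    unfolding u_adj unfolding u_def mult_smult_assoc_mat[OF wC smult_carrier_mat[OF wC']] mult_smult_distrib[OF wC wC'] d \<open>d = c\<close>
      smult_smult_mat by (simp add: mult.assoc)
  moreover have "p * u = u" unfolding u_def mult_smult_distrib[OF p(2) wC] pw by (rule refl)
  moreover have "u * q = u" unfolding u_def mult_smult_assoc_mat[OF wC q(2)] wq by (rule refl)
  moreover have "u \<in> S" unfolding u_def using wS by (rule mem_smult)
  ultimately have "is_link p q u" by (simp add: is_link_def kk)
  then show ?thesis by blast
qed

text \<open>Reflexivity and symmetry come from p p p = p and from adjoints. Transitivity needs
  partial isometries: for links \<open>u\<close> from \<open>q\<close> to \<open>p\<close> and
  \<open>v\<close> from \<open>r\<close> to \<open>q\<close>, the product u v satisfies
  \<open>mat_adjoint (u * v) * (u * v) = r\<close>, hence is nonzero.\<close>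

lemma equiv_linked: "equiv R linked"
proof (rule equivI)
  show "linked \<subseteq> R \<times> R" by (auto simp: linked_def)
  show "refl_on R linked"
  proof (rule refl_onI)
    fix p assume "p \<in> R"
    note p = projD[OF this]
    have "p * p * p \<noteq> 0\<^sub>m N N" using p(3,4) by simp
    then show "(p, p) \<in> linked" using \<open>p \<in> R\<close> p(1) unfolding linked_def by blast
  qed
  show "sym linked"
  proof (rule symI)
    fix p q assume "(p, q) \<in> linked"
    then obtain x where R: "p \<in> R" "q \<in> R" and x: "x \<in> S" "p * x * q \<noteq> 0\<^sub>m N N"
      unfolding linked_def by blast
    note p = projD[OF R(1)] and q = projD[OF R(2)] and xC = mem_carrier[OF x(1)]
    have "mat_adjoint (p * x * q) = q * mat_adjoint x * p"
      unfolding mat_adjoint_mult[OF mult_carrier_mat[OF p(2) xC] q(2)] mat_adjoint_mult[OF p(2) xC] p(5) q(5)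
      by (rule square_mult_assoc[OF q(2) mat_adjoint_carrier[OF xC] p(2), symmetric])
    then have "q * mat_adjoint x * p \<noteq> 0\<^sub>m N N" using x(2) mat_adjoint_eq_0_iff[of "p * x * q" N N] by simp
    then show "(q, p) \<in> linked" using R mem_adjoint[OF x(1)] unfolding linked_def by blast
  qed
  show "trans linked"
  proof (rule transI)
    fix p q r assume pq: "(p, q) \<in> linked" and qr: "(q, r) \<in> linked"
    then have R: "p \<in> R" "q \<in> R" "r \<in> R" unfolding linked_def by auto
    obtain u where u: "is_link p q u" using ex_link[OF pq] by blast
    obtain v where v: "is_link q r v" using ex_link[OF qr] by blast
    have uv: "u \<in> S" "v \<in> S" using u v by (auto simp: is_link_def)
    note C = uv[THEN mem_carrier] and C' = uv[THEN mem_carrier, THEN mat_adjoint_carrier]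
    note p = projD[OF R(1)] and q = projD[OF R(2)] and r = projD[OF R(3)]
    have "p * (u * v) * r = (p * u) * (v * r)"
      using C p(2) r(2) by (simp add: square_mult_simps[where N = N])
    also have "\<dots> = u * v" using u v by (simp add: is_link_def)
    finally have eq: "p * (u * v) * r = u * v" .
    have "mat_adjoint (u * v) * (u * v) = mat_adjoint v * ((mat_adjoint u * u) * v)"
      unfolding mat_adjoint_mult[OF C] using C C' by (simp add: square_mult_simps[where N = N])
    also have "\<dots> = mat_adjoint v * (q * v)" using u by (simp add: is_link_def)
    also have "\<dots> = r" using v by (simp add: is_link_def)
    finally have "u * v \<noteq> 0\<^sub>m N N"
      using r(3) adjoint_mult_eq_0_iff[OF mult_carrier_mat[OF C]] by auto
    then show "(p, r) \<in> linked" using R(1,3) eq mem_mult[OF uv] unfolding linked_def by auto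
  qed
qed

text \<open>One projection is fixed in each class, and \<open>link p\<close> is a partial isometry
  from it to \<open>p\<close>. A unit for (p, q) passes from \<open>q\<close> through the common
  representative to \<open>p\<close>; the inner factors of a product of units then cancel exactly,
  whereas links chosen separately for each pair would agree only up to phases.\<close>

definition representative :: "complex mat \<Rightarrow> complex mat" where
  "representative p = (SOME q. q \<in> linked `` {p})"

definition link :: "complex mat \<Rightarrow> complex mat" where
  "link p = (SOME u. is_link p (representative p) u)"

definition matrix_unit :: "complex mat \<times> complex mat \<Rightarrow> complex mat" where
  "matrix_unit a = link (fst a) * mat_adjoint (link (snd a))"

lemma representative_eq:
  assumes "(p, q) \<in> linked"
  shows "representative p = representative q"
  by (simp only: representative_def equiv_class_eq[OF equiv_linked assms])

lemma is_link_link: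
  assumes "p \<in> R"
  shows "is_link p (representative p) (link p)"
proof -
  have "p \<in> linked `` {p}" using equiv_class_self[OF equiv_linked assms] .
  then have "representative p \<in> linked `` {p}"
    unfolding representative_def by (rule someI)
  then have "(p, representative p) \<in> linked" by simp
  then show ?thesis unfolding link_def by (rule someI_ex[OF ex_link])
qed

lemma linked_mem: "(p, q) \<in> linked \<Longrightarrow> p \<in> R" "(p, q) \<in> linked \<Longrightarrow> q \<in> R"
  by (auto simp: linked_def)

lemmas link_props = is_link_link[unfolded is_link_def]

lemma link_mem: "p \<in> R \<Longrightarrow> link p \<in> S"
  using link_props by blast

lemma matrix_unit_mem: "p \<in> R \<Longrightarrow> q \<in> R \<Longrightarrow> matrix_unit (p, q) \<in> S"
  unfolding matrix_unit_def fst_conv snd_conv by (intro mem_mult mem_adjoint link_mem)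

lemma matrix_unit_diag: "p \<in> R \<Longrightarrow> matrix_unit (p, p) = p"
  unfolding matrix_unit_def fst_conv snd_conv using link_props by blast

lemma matrix_unit_adjoint:
  assumes "p \<in> R" "q \<in> R"
  shows "mat_adjoint (matrix_unit (p, q)) = matrix_unit (q, p)"
proof -
  note C = link_mem[OF assms(1), THEN mem_carrier] link_mem[OF assms(2), THEN mem_carrier]
  show ?thesis
    unfolding matrix_unit_def fst_conv snd_conv mat_adjoint_mult[OF C(1) mat_adjoint_carrier[OF C(2)]] mat_adjoint_adjoint
    by (rule refl)
qed

lemma matrix_unit_mult:
  assumes pq: "(p, q) \<in> linked" and st: "(s, t) \<in> linked"
  shows "matrix_unit (p, q) * matrix_unit (s, t) = (if q = s then matrix_unit (p, t) else 0\<^sub>m N N)"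
proof -
  have R: "p \<in> R" "q \<in> R" "s \<in> R" "t \<in> R" using linked_mem pq st by auto
  note C = R[THEN link_mem, THEN mem_carrier]
  note C' = R[THEN link_mem, THEN mem_carrier, THEN mat_adjoint_carrier]
  note L = R[THEN link_props]
  have "matrix_unit (p, q) * matrix_unit (s, t) = link p * ((mat_adjoint (link q) * link s) * mat_adjoint (link t))"
    unfolding matrix_unit_def using C C' by (simp add: square_mult_simps[where N = N])
  also have "\<dots> = (if q = s then matrix_unit (p, t) else 0\<^sub>m N N)"
  proof (cases "q = s")
    case True
    then have "mat_adjoint (link q) * link s = representative p"
      using L(2) representative_eq[OF pq] by simp
    moreover have rC: "representative p \<in> carrier_mat N N"
      using L(1) mult_carrier_mat[OF C'(1) C(1)] by auto
    ultimately show ?thesis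
      using True L(1) square_mult_assoc[OF C(1) rC C'(4)] by (simp add: matrix_unit_def)
  next
    case False
    note q = projD[OF R(2)] and s = projD[OF R(3)]
    have "mat_adjoint (link q) = mat_adjoint (q * link q)" using L(2) by simp
    also have "\<dots> = mat_adjoint (link q) * q" unfolding mat_adjoint_mult[OF q(2) C(2)] q(5) by (rule refl)
    finally have "mat_adjoint (link q) * link s = (mat_adjoint (link q) * q) * (s * link s)" using L(3) by simp
    also have "\<dots> = mat_adjoint (link q) * ((q * s) * link s)"
      using C(3) C'(2) q(2) s(2) by (simp add: square_mult_simps[where N = N])
    also have "\<dots> = 0\<^sub>m N N"
      unfolding orthogonal[OF R(2,3) False] left_mult_zero_mat[OF C(3)] right_mult_zero_mat[OF C'(2)] by (rule refl)
    finally show ?thesis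
      using False left_mult_zero_mat[OF C'(4)] right_mult_zero_mat[OF C(1)] by simp
  qed
  finally show ?thesis .
qed

lemma matrix_units_linked: "matrix_units N R linked matrix_unit"
  unfolding matrix_units_def
proof (intro conjI ballI)
  fix a assume "a \<in> linked"
  then obtain p q where a: "a = (p, q)" "(p, q) \<in> linked" by (cases a) auto
  have R: "p \<in> R" "q \<in> R" using linked_mem a(2) by auto
  show "matrix_unit a \<in> carrier_mat N N" unfolding a using matrix_unit_mem[OF R] by (rule mem_carrier)
  show "mat_adjoint (matrix_unit a) = matrix_unit (prod.swap a)" unfolding a using matrix_unit_adjoint[OF R] by simp
  have "(q, p) \<in> linked" using a(2) equiv_linked by (meson equivE symE)
  then have eq: "matrix_unit (p, q) * matrix_unit (q, p) = p"
    using matrix_unit_mult[OF a(2)] matrix_unit_diag[OF R(1)] by simp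
  show "matrix_unit a \<noteq> 0\<^sub>m N N"
  proof
    assume "matrix_unit a = 0\<^sub>m N N"
    then have "p = 0\<^sub>m N N * matrix_unit (q, p)" using eq by (simp add: a)
    also have "\<dots> = 0\<^sub>m N N" using matrix_unit_mem[OF R(2,1), THEN mem_carrier] by (rule left_mult_zero_mat)
    finally show False using projD(3)[OF R(1)] by simp
  qed
next
  fix a b assume "a \<in> linked" "b \<in> linked"
  then show "matrix_unit a * matrix_unit b = (if snd a = fst b then matrix_unit (fst a, snd b) else 0\<^sub>m N N)"
    using matrix_unit_mult[of "fst a" "snd a" "fst b" "snd b"] by simp
qed (rule finite_family equiv_linked)+

text \<open>With \<open>u\<close> the matrix unit at \<open>(p, q)\<close>, \<open>p x q = u (u\<^sup>* x q)\<close> and \<open>u\<^sup>* x q\<close> lies in \<open>q S q\<close>.\<close>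

lemma corner_eq:
  assumes pq: "(p, q) \<in> linked" and x: "x \<in> S"
  shows "\<exists>c. p * (x * q) = c \<cdot>\<^sub>m matrix_unit (p, q)"
proof -
  have R: "p \<in> R" "q \<in> R" using linked_mem pq by auto
  have qp: "(q, p) \<in> linked" using pq equiv_linked by (meson equivE symE)
  have pp: "(p, p) \<in> linked" and qq: "(q, q) \<in> linked"
    using R equiv_linked by (meson equivE refl_onD)+
  define u v where "u = matrix_unit (p, q)" and "v = matrix_unit (q, p)"
  have uv: "u \<in> S" "v \<in> S" unfolding u_def v_def using R by (simp_all add: matrix_unit_mem)
  note C = uv[THEN mem_carrier]
  note p = projD[OF R(1)] and q = projD[OF R(2)] and xC = mem_carrier[OF x]
  have e: "u * v = p" "u * q = u" "q * v = v"
    using matrix_unit_mult[OF pq qp] matrix_unit_mult[OF pq qq] matrix_unit_mult[OF qq qp]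
      matrix_unit_diag[OF R(1)] matrix_unit_diag[OF R(2)] by (simp_all add: u_def v_def)
  obtain c where c: "q * (v * x) * q = c \<cdot>\<^sub>m q" using q(6)[OF mem_mult[OF uv(2) x]] by blast
  have qv: "q * (v * y) = v * y" if "y \<in> carrier_mat N N" for y
    using square_mult_assoc[OF q(2) C(2) that] e(3) by simp
  have "p * (x * q) = u * (v * (x * q))"
    using square_mult_assoc[OF C mult_carrier_mat[OF xC q(2)]] e(1) by simp
  also have "v * (x * q) = q * (v * x) * q"
    using C q(2) xC by (simp add: square_mult_simps[where N = N] qv)
  also have "u * (q * (v * x) * q) = c \<cdot>\<^sub>m u"
    unfolding c mult_smult_distrib[OF C(1) q(2)] e(2) by (rule refl)
  finally show ?thesis unfolding u_def by blast
qed

text \<open>Multiplying by the unit on both sides splits \<open>x\<close> into the corners p x q.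
  Those of unlinked pairs vanish by the definition of \<open>linked\<close>, and the others are
  scalar multiples of the matrix unit.\<close>

lemma range_unit_combination: "S = range (unit_combination N linked matrix_unit)"
proof (intro equalityI subsetI)
  have fin: "finite linked"
    by (rule finite_subset[of linked "R \<times> R"]) (use finite_family in \<open>auto simp: linked_def\<close>)
  show "x \<in> S" if "x \<in> range (unit_combination N linked matrix_unit)" for x
  proof -
    from that obtain c where x: "x = unit_combination N linked matrix_unit c" by (elim rangeE)
    show ?thesis unfolding x unit_combination_def
      using fin by (rule big_sum_mat_mem) (auto simp: linked_def intro: mem_smult matrix_unit_mem)
  qed
  show "x \<in> range (unit_combination N linked matrix_unit)" if x: "x \<in> S" for x
  proof -
    note xC = mem_carrier[OF x]
    let ?Q = "big_sum_mat N (\<lambda>p. p) R"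
    define c where "c a = (SOME c. fst a * (x * snd a) = c \<cdot>\<^sub>m matrix_unit a)" for a
    have c: "fst a * (x * snd a) = c a \<cdot>\<^sub>m matrix_unit a" if "a \<in> linked" for a
    proof -
      have "(fst a, snd a) \<in> linked" using that by simp
      from someI_ex[OF corner_eq[OF this x]] show ?thesis unfolding c_def by simp
    qed
    have "x = ?Q * (x * ?Q)" using complete_left[OF x] complete_right[OF x] by simp
    also have "\<dots> = big_sum_mat N (\<lambda>p. p * (x * ?Q)) R"
      by (rule big_sum_mat_mult[OF mult_carrier_mat[OF xC big_sum_mat_carrier] projD(2)])
    also have "\<dots> = big_sum_mat N (\<lambda>p. big_sum_mat N (\<lambda>q. p * (x * q)) R) R"
    proof (rule big_sum_mat_cong)
      fix p assume p: "p \<in> R"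
      have "x * ?Q = big_sum_mat N (\<lambda>q. x * q) R" by (rule mult_big_sum_mat[OF xC projD(2)])
      then show "p * (x * ?Q) = big_sum_mat N (\<lambda>q. p * (x * q)) R"
        using mult_big_sum_mat[OF projD(2)[OF p], of R "\<lambda>q. x * q"] mult_carrier_mat[OF xC projD(2)] by simp
    qed
    also have "\<dots> = big_sum_mat N (\<lambda>(p, q). p * (x * q)) (R \<times> R)" by (rule big_sum_mat_nested)
    also have "\<dots> = big_sum_mat N (\<lambda>(p, q). p * (x * q)) linked"
    proof (rule big_sum_mat_mono_neutral)
      fix a assume "a \<in> R \<times> R - linked"
      then obtain p q where a: "a = (p, q)" "p \<in> R" "q \<in> R" "p * x * q = 0\<^sub>m N N"
        using x by (auto simp: linked_def)
      then show "(\<lambda>(p, q). p * (x * q)) a = 0\<^sub>m N N"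
        using square_mult_assoc[OF projD(2)[OF a(2)] xC projD(2)[OF a(3)]] by simp
    qed (use finite_family in \<open>auto simp: linked_def\<close>)
    also have "\<dots> = unit_combination N linked matrix_unit c"
      unfolding unit_combination_def by (rule big_sum_mat_cong) (use c in \<open>simp add: case_prod_beta\<close>)
    finally show ?thesis by blast
  qed
qed

end

section \<open>Coefficients with respect to matrix units\<close>

lemma matrix_unitsD:
  assumes "matrix_units N I E e"
  shows "finite I" "equiv I E" "finite E" "E \<subseteq> I \<times> I"
    "a \<in> E \<Longrightarrow> e a \<in> carrier_mat N N" "a \<in> E \<Longrightarrow> e a \<noteq> 0\<^sub>m N N"
    "a \<in> E \<Longrightarrow> mat_adjoint (e a) = e (prod.swap a)"
    "a \<in> E \<Longrightarrow> b \<in> E \<Longrightarrow> e a * e b = (if snd a = fst b then e (fst a, snd b) else 0\<^sub>m N N)"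
proof -
  show fin: "finite I" and eq: "equiv I E" using assms unfolding matrix_units_def by auto
  show sub: "E \<subseteq> I \<times> I" using eq by (rule equiv_type)
  show "finite E" using sub fin by (rule finite_subset[OF _ finite_SigmaI]) (use fin in auto)
  show "a \<in> E \<Longrightarrow> e a \<in> carrier_mat N N" "a \<in> E \<Longrightarrow> e a \<noteq> 0\<^sub>m N N"
    "a \<in> E \<Longrightarrow> mat_adjoint (e a) = e (prod.swap a)"
    "a \<in> E \<Longrightarrow> b \<in> E \<Longrightarrow> e a * e b = (if snd a = fst b then e (fst a, snd b) else 0\<^sub>m N N)"
    using assms unfolding matrix_units_def by blast+
qed

text \<open>Cutting with two diagonal units isolates a single coefficient; linear independence of
  the units follows.\<close>

lemma matrix_units_coefficient:
  assumes mu: "matrix_units N I E e" and pq: "(p, q) \<in> E"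
  shows "(e (p, p) * unit_combination N E e c) * e (q, q) = c (p, q) \<cdot>\<^sub>m e (p, q)"
proof -
  note D = matrix_unitsD[OF mu]
  have pp: "(p, p) \<in> E" and qq: "(q, q) \<in> E"
    using pq D(2,4) by (meson equivE refl_onD mem_Sigma_iff subsetD)+
  have ppC: "e (p, p) \<in> carrier_mat N N" and qqC: "e (q, q) \<in> carrier_mat N N"
    using D(5) pp qq by blast+
  have summand: "(e (p, p) * (c a \<cdot>\<^sub>m e a)) * e (q, q) =
      c a \<cdot>\<^sub>m (if a = (p, q) then e (p, q) else 0\<^sub>m N N)" if a: "a \<in> E" for a
  proof -
    have aC: "e a \<in> carrier_mat N N" using a by (rule D(5))
    have "(e (p, p) * (c a \<cdot>\<^sub>m e a)) * e (q, q) = c a \<cdot>\<^sub>m ((e (p, p) * e a) * e (q, q))"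
      unfolding mult_smult_distrib[OF ppC aC] mult_smult_assoc_mat[OF mult_carrier_mat[OF ppC aC] qqC] by (rule refl)
    also have "(e (p, p) * e a) * e (q, q) = (if a = (p, q) then e (p, q) else 0\<^sub>m N N)"
    proof (cases "fst a = p")
      case True
      then have "(p, snd a) \<in> E" using a by (cases a) auto
      then have "e (p, snd a) * e (q, q) = (if snd a = q then e (p, q) else 0\<^sub>m N N)"
        using D(8)[OF _ qq, of "(p, snd a)"] by simp
      moreover have "e (p, p) * e a = e (p, snd a)" using D(8)[OF pp a] True by simp
      ultimately show ?thesis using True by (cases a) auto
    next
      case False
      then have "e (p, p) * e a = 0\<^sub>m N N" using D(8)[OF pp a] by auto
      then show ?thesis using False left_mult_zero_mat[OF qqC] by auto
    qed
    finally show ?thesis .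
  qed
  have C: "c a \<cdot>\<^sub>m e a \<in> carrier_mat N N" if "a \<in> E" for a
    using D(5)[OF that] by (rule smult_carrier_mat)
  have "(e (p, p) * unit_combination N E e c) * e (q, q) =
      big_sum_mat N (\<lambda>a. e (p, p) * (c a \<cdot>\<^sub>m e a)) E * e (q, q)"
    unfolding unit_combination_def using mult_big_sum_mat[OF ppC, of E "\<lambda>a. c a \<cdot>\<^sub>m e a"] C by simp
  also have "\<dots> = big_sum_mat N (\<lambda>a. (e (p, p) * (c a \<cdot>\<^sub>m e a)) * e (q, q)) E"
    by (rule big_sum_mat_mult[OF qqC mult_carrier_mat[OF ppC C]])
  also have "\<dots> = big_sum_mat N (\<lambda>a. c a \<cdot>\<^sub>m (if a = (p, q) then e (p, q) else 0\<^sub>m N N)) E"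
    by (rule big_sum_mat_cong) (rule summand)
  also have "\<dots> = c (p, q) \<cdot>\<^sub>m (if (p, q) = (p, q) then e (p, q) else 0\<^sub>m N N)"
    by (rule big_sum_mat_single[OF D(3) pq]) (use C[OF pq] in \<open>auto intro!: eq_matI\<close>)
  finally show ?thesis by simp
qed

lemma unit_combination_eqD:
  assumes mu: "matrix_units N I E e" and eq: "unit_combination N E e c = unit_combination N E e d"
    and a: "a \<in> E"
  shows "c a = d a"
proof -
  obtain p q where pq: "a = (p, q)" by (cases a)
  have "c (p, q) \<cdot>\<^sub>m e (p, q) = d (p, q) \<cdot>\<^sub>m e (p, q)"
    using matrix_units_coefficient[OF mu, of p q c] matrix_units_coefficient[OF mu, of p q d] a eq
    unfolding pq by simp
  then show ?thesis unfolding pq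
    by (rule smult_mat_cancel[OF matrix_unitsD(5,6)[OF mu a, unfolded pq]])
qed

lemma unit_combination_cong:
  "(\<And>a. a \<in> E \<Longrightarrow> c a = d a) \<Longrightarrow> unit_combination N E e c = unit_combination N E e d"
  unfolding unit_combination_def by (rule big_sum_mat_cong) simp

lemma unit_combination_carrier [simp]: "unit_combination N E e c \<in> carrier_mat N N"
  and dim_unit_combination [simp]: "dim_row (unit_combination N E e c) = N"
    "dim_col (unit_combination N E e c) = N"
  by (simp_all add: unit_combination_def)

lemma unit_combination_index:
  assumes "matrix_units N I E e" "i < N" "j < N"
  shows "unit_combination N E e c $$ (i, j) = (\<Sum>a\<in>E. c a * e a $$ (i, j))"
  unfolding unit_combination_def big_sum_mat_index[OF assms(2,3)]
proof (rule sum.cong)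
  fix a assume "a \<in> E"
  then have "e a \<in> carrier_mat N N" by (rule matrix_unitsD(5)[OF assms(1)])
  then show "(c a \<cdot>\<^sub>m e a) $$ (i, j) = c a * e a $$ (i, j)" using assms(2,3) by simp
qed simp

lemma unit_combination_add:
  assumes "matrix_units N I E e"
  shows "unit_combination N E e c + unit_combination N E e d = unit_combination N E e (\<lambda>a. c a + d a)"
proof (rule eq_matI)
  fix i j
  assume "i < dim_row (unit_combination N E e (\<lambda>a. c a + d a))" "j < dim_col (unit_combination N E e (\<lambda>a. c a + d a))"
  then have ij: "i < N" "j < N" by simp_all
  show "(unit_combination N E e c + unit_combination N E e d) $$ (i, j) =
      unit_combination N E e (\<lambda>a. c a + d a) $$ (i, j)"
    using ij
    by (simp add: unit_combination_index[OF assms ij] distrib_right sum.distrib)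
qed simp_all

lemma unit_combination_smult:
  assumes "matrix_units N I E e"
  shows "b \<cdot>\<^sub>m unit_combination N E e c = unit_combination N E e (\<lambda>a. b * c a)"
proof (rule eq_matI)
  fix i j
  assume "i < dim_row (unit_combination N E e (\<lambda>a. b * c a))" "j < dim_col (unit_combination N E e (\<lambda>a. b * c a))"
  then have ij: "i < N" "j < N" by simp_all
  show "(b \<cdot>\<^sub>m unit_combination N E e c) $$ (i, j) = unit_combination N E e (\<lambda>a. b * c a) $$ (i, j)"
    using ij
    by (simp add: unit_combination_index[OF assms ij] sum_distrib_left mult.assoc)
qed simp_all

text \<open>The product of block matrices, written for coefficient functions. It mentions neither
  the size \<open>N\<close> nor the units \<open>e\<close>, which is what makes algebras with the
  same \<open>E\<close> isomorphic.\<close>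

definition unit_product ::
  "('i \<times> 'i) set \<Rightarrow> ('i \<times> 'i \<Rightarrow> complex) \<Rightarrow> ('i \<times> 'i \<Rightarrow> complex) \<Rightarrow> 'i \<times> 'i \<Rightarrow> complex" where
  "unit_product E c d a =
     (\<Sum>b\<in>E. \<Sum>b'\<in>E. if snd b = fst b' \<and> a = (fst b, snd b') then c b * d b' else 0)"

lemma unit_combination_mult:
  assumes mu: "matrix_units N I E e"
  shows "unit_combination N E e c * unit_combination N E e d = unit_combination N E e (unit_product E c d)"
proof (rule eq_matI)
  note D = matrix_unitsD[OF mu]
  fix i j
  assume "i < dim_row (unit_combination N E e (unit_product E c d))"
    "j < dim_col (unit_combination N E e (unit_product E c d))"
  then have ij: "i < N" "j < N" by simp_all
  have e_mult: "(\<Sum>l<N. e b $$ (i, l) * e b' $$ (l, j)) =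
      (\<Sum>a\<in>E. if snd b = fst b' \<and> a = (fst b, snd b') then e a $$ (i, j) else 0)"
    if b: "b \<in> E" "b' \<in> E" for b b'
  proof -
    have "(\<Sum>l<N. e b $$ (i, l) * e b' $$ (l, j)) = (e b * e b') $$ (i, j)"
      by (rule index_mult_mat_sum[OF D(5)[OF b(1)] D(5)[OF b(2)] ij, symmetric])
    also have "\<dots> = (\<Sum>a\<in>E. if snd b = fst b' \<and> a = (fst b, snd b') then e a $$ (i, j) else 0)"
    proof (cases "snd b = fst b'")
      case True
      then have "(fst b, fst b') \<in> E" "(fst b', snd b') \<in> E" using b by (metis prod.collapse)+
      then have "(fst b, snd b') \<in> E" using D(2) by (meson equivE transD)
      then show ?thesis using True D(3) by (simp add: D(8)[OF b])
    next
      case False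
      then show ?thesis using ij by (simp add: D(8)[OF b])
    qed
    finally show ?thesis .
  qed
  have "(unit_combination N E e c * unit_combination N E e d) $$ (i, j) =
      (\<Sum>l<N. (\<Sum>b\<in>E. c b * e b $$ (i, l)) * (\<Sum>b'\<in>E. d b' * e b' $$ (l, j)))"
    unfolding index_mult_mat_sum[OF unit_combination_carrier unit_combination_carrier ij]
    by (intro sum.cong) (simp_all add: unit_combination_index[OF mu] ij)
  also have "\<dots> = (\<Sum>l<N. \<Sum>b\<in>E. \<Sum>b'\<in>E. c b * d b' * (e b $$ (i, l) * e b' $$ (l, j)))"
    unfolding sum_product by (intro sum.cong refl) (simp add: mult_ac)
  also have "\<dots> = (\<Sum>b\<in>E. \<Sum>l<N. \<Sum>b'\<in>E. c b * d b' * (e b $$ (i, l) * e b' $$ (l, j)))"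
    by (rule sum.swap)
  also have "\<dots> = (\<Sum>b\<in>E. \<Sum>b'\<in>E. \<Sum>l<N. c b * d b' * (e b $$ (i, l) * e b' $$ (l, j)))"
    by (intro sum.cong refl sum.swap)
  also have "\<dots> = (\<Sum>b\<in>E. \<Sum>b'\<in>E. \<Sum>a\<in>E.
      (if snd b = fst b' \<and> a = (fst b, snd b') then c b * d b' else 0) * e a $$ (i, j))"
  proof (intro sum.cong refl)
    fix b b' assume b: "b \<in> E" "b' \<in> E"
    have "(\<Sum>l<N. c b * d b' * (e b $$ (i, l) * e b' $$ (l, j))) =
        c b * d b' * (\<Sum>a\<in>E. if snd b = fst b' \<and> a = (fst b, snd b') then e a $$ (i, j) else 0)"
      unfolding e_mult[OF b, symmetric] by (rule sum_distrib_left[symmetric])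
    also have "\<dots> = (\<Sum>a\<in>E. (if snd b = fst b' \<and> a = (fst b, snd b') then c b * d b' else 0) * e a $$ (i, j))"
      unfolding sum_distrib_left by (intro sum.cong) simp_all
    finally show "(\<Sum>l<N. c b * d b' * (e b $$ (i, l) * e b' $$ (l, j))) =
        (\<Sum>a\<in>E. (if snd b = fst b' \<and> a = (fst b, snd b') then c b * d b' else 0) * e a $$ (i, j))" .
  qed
  also have "\<dots> = (\<Sum>b\<in>E. \<Sum>a\<in>E. \<Sum>b'\<in>E.
      (if snd b = fst b' \<and> a = (fst b, snd b') then c b * d b' else 0) * e a $$ (i, j))"
    by (intro sum.cong refl sum.swap)
  also have "\<dots> = (\<Sum>a\<in>E. \<Sum>b\<in>E. \<Sum>b'\<in>E.
      (if snd b = fst b' \<and> a = (fst b, snd b') then c b * d b' else 0) * e a $$ (i, j))"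
    by (rule sum.swap)
  also have "\<dots> = unit_combination N E e (unit_product E c d) $$ (i, j)"
    unfolding unit_combination_index[OF mu ij] unit_product_def sum_distrib_right by (rule refl)
  finally show "(unit_combination N E e c * unit_combination N E e d) $$ (i, j) =
      unit_combination N E e (unit_product E c d) $$ (i, j)" .
qed simp_all

lemma unit_combination_adjoint:
  assumes mu: "matrix_units N I E e"
  shows "mat_adjoint (unit_combination N E e c) = unit_combination N E e (\<lambda>a. cnj (c (prod.swap a)))"
proof -
  note D = matrix_unitsD[OF mu]
  have swap: "prod.swap a \<in> E" if "a \<in> E" for a
    using that D(2) by (cases a) (simp, meson equivE symE)
  have bij: "bij_betw prod.swap E E"
    by (rule bij_betw_byWitness[of _ prod.swap]) (use swap in auto)
  have C: "c a \<cdot>\<^sub>m e a \<in> carrier_mat N N" if "a \<in> E" for a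
    using D(5)[OF that] by (rule smult_carrier_mat)
  have "mat_adjoint (unit_combination N E e c) = big_sum_mat N (\<lambda>a. mat_adjoint (c a \<cdot>\<^sub>m e a)) E"
    unfolding unit_combination_def by (rule adjoint_big_sum_mat) (rule C)
  also have "\<dots> = big_sum_mat N (\<lambda>a. cnj (c (prod.swap (prod.swap a))) \<cdot>\<^sub>m e (prod.swap a)) E"
    by (rule big_sum_mat_cong) (simp add: mat_adjoint_smult D(7))
  also have "\<dots> = unit_combination N E e (\<lambda>a. cnj (c (prod.swap a)))"
    unfolding unit_combination_def by (rule big_sum_mat_reindex[OF bij, symmetric])
  finally show ?thesis .
qed

text \<open>The isomorphism keeps the coefficients and replaces the units. It is well defined and
  injective because coefficients are unique on \<open>E\<close>, and it respects the operations
  because each of them acts on coefficients by the same formula on both sides.\<close>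

lemma star_isomorphic_range_unit_combination:
  assumes mu: "matrix_units N I E e" and mu': "matrix_units N' I E e'"
  shows "star_isomorphic (mat_star_algebra N\<lparr>carrier := range (unit_combination N E e)\<rparr>)
    (mat_star_algebra N'\<lparr>carrier := range (unit_combination N' E e')\<rparr>)"
proof -
  let ?L = "unit_combination N E e" and ?L' = "unit_combination N' E e'"
  define \<theta> where "\<theta> x = ?L' (SOME c. ?L c = x)" for x
  have \<theta>: "\<theta> (?L c) = ?L' c" for c
  proof -
    have "?L (SOME d. ?L d = ?L c) = ?L c" by (rule someI[of "\<lambda>d. ?L d = ?L c" c]) (rule refl)
    then show ?thesis unfolding \<theta>_def
      by (intro unit_combination_cong) (rule unit_combination_eqD[OF mu])
  qed
  have "bij_betw \<theta> (range ?L) (range ?L')"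
  proof (rule bij_betw_imageI)
    show "inj_on \<theta> (range ?L)"
    proof (rule inj_onI)
      fix x y assume "x \<in> range ?L" "y \<in> range ?L" and eq: "\<theta> x = \<theta> y"
      then obtain c d where xy: "x = ?L c" "y = ?L d" by (elim rangeE)
      show "x = y" using eq unfolding xy \<theta>
        by (intro unit_combination_cong) (rule unit_combination_eqD[OF mu'])
    qed
    show "\<theta> ` range ?L = range ?L'" unfolding image_image \<theta> by (rule refl)
  qed
  moreover have "star_hom (mat_star_algebra N\<lparr>carrier := range ?L\<rparr>) (mat_star_algebra N'\<lparr>carrier := range ?L'\<rparr>) \<theta>"
    unfolding star_hom_def mat_star_algebra_def
    by (auto simp: \<theta> unit_combination_add[OF mu] unit_combination_add[OF mu']
        unit_combination_smult[OF mu] unit_combination_smult[OF mu']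
        unit_combination_mult[OF mu] unit_combination_mult[OF mu']
        unit_combination_adjoint[OF mu] unit_combination_adjoint[OF mu'])
  ultimately show ?thesis unfolding star_isomorphic_def by (auto simp: mat_star_algebra_def)
qed

text \<open>Only the labels move: the units and the algebra they span stay the same. Two systems can
  thus be brought to a common index set and relation before they are compared.\<close>

lemma matrix_units_reindex:
  assumes mu: "matrix_units N J F e" and E: "equiv I E" and h: "bij_betw h I J"
    and rel: "\<And>x y. x \<in> I \<Longrightarrow> y \<in> I \<Longrightarrow> (x, y) \<in> E \<longleftrightarrow> (h x, h y) \<in> F"
  shows "matrix_units N I E (\<lambda>a. e (map_prod h h a))"
    and "range (unit_combination N E (\<lambda>a. e (map_prod h h a))) = range (unit_combination N F e)"
proof -
  note D = matrix_unitsD[OF mu]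
  have EI: "E \<subseteq> I \<times> I" using E by (rule equiv_type)
  have hE: "map_prod h h a \<in> F" if "a \<in> E" for a
    using that EI rel by (cases a) auto
  have inj: "x \<in> I \<Longrightarrow> y \<in> I \<Longrightarrow> h x = h y \<longleftrightarrow> x = y" for x y
    using h by (auto simp: bij_betw_def inj_on_def)
  show "matrix_units N I E (\<lambda>a. e (map_prod h h a))"
    unfolding matrix_units_def
  proof (intro conjI ballI)
    show "finite I" using h D(1) by (simp add: bij_betw_finite)
    show "equiv I E" by (rule E)
  next
    fix a assume a: "a \<in> E"
    show "e (map_prod h h a) \<in> carrier_mat N N" "e (map_prod h h a) \<noteq> 0\<^sub>m N N"
      using D(5,6)[OF hE[OF a]] .
    show "mat_adjoint (e (map_prod h h a)) = e (map_prod h h (prod.swap a))"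
      using D(7)[OF hE[OF a]] by (cases a) simp
  next
    fix a b assume ab: "a \<in> E" "b \<in> E"
    then have "snd a \<in> I" "fst b \<in> I" using EI by auto
    then show "e (map_prod h h a) * e (map_prod h h b) =
        (if snd a = fst b then e (map_prod h h (fst a, snd b)) else 0\<^sub>m N N)"
      using D(8)[OF hE[OF ab(1)] hE[OF ab(2)]] inj by (cases a; cases b) simp
  qed
  have bij: "bij_betw (map_prod h h) E F"
    unfolding bij_betw_def
  proof (intro conjI inj_onI equalityI subsetI)
    fix a b assume "a \<in> E" "b \<in> E" "map_prod h h a = map_prod h h b"
    then show "a = b" using EI inj by (cases a; cases b) auto
  next
    fix b assume "b \<in> F"
    moreover obtain p q where b: "b = (p, q)" by (cases b)
    ultimately have "p \<in> J" "q \<in> J" using D(4) by auto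
    then obtain x y where "x \<in> I" "y \<in> I" "p = h x" "q = h y"
      using h by (auto simp: bij_betw_def)
    then show "b \<in> map_prod h h ` E" using \<open>b \<in> F\<close> rel unfolding b by force
  qed (use hE in auto)
  have eq: "unit_combination N F e c = unit_combination N E (\<lambda>a. e (map_prod h h a)) (\<lambda>a. c (map_prod h h a))" for c
    unfolding unit_combination_def by (rule big_sum_mat_reindex[OF bij])
  show "range (unit_combination N E (\<lambda>a. e (map_prod h h a))) = range (unit_combination N F e)"
  proof (intro equalityI subsetI)
    fix x assume "x \<in> range (unit_combination N F e)"
    then obtain c where "x = unit_combination N F e c" by (elim rangeE)
    then show "x \<in> range (unit_combination N E (\<lambda>a. e (map_prod h h a)))" unfolding eq by blast
  next
    fix x assume "x \<in> range (unit_combination N E (\<lambda>a. e (map_prod h h a)))"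
    then obtain c where x: "x = unit_combination N E (\<lambda>a. e (map_prod h h a)) c" by (elim rangeE)
    define d where "d b = c (the_inv_into E (map_prod h h) b)" for b
    have "x = unit_combination N F e d" unfolding x eq
    proof (rule unit_combination_cong)
      fix a assume "a \<in> E"
      then show "c a = d (map_prod h h a)"
        unfolding d_def using bij by (simp add: the_inv_into_f_f bij_betw_def)
    qed
    then show "x \<in> range (unit_combination N F e)" by blast
  qed
qed

section \<open>Equivalence relations with equal class sizes\<close>

lemma image_mset_eq_ex_bij:
  assumes "finite X" "finite Y" "image_mset f (mset_set X) = image_mset g (mset_set Y)"
  shows "\<exists>h. bij_betw h X Y \<and> (\<forall>x\<in>X. g (h x) = f x)"
  using assms
proof (induction X arbitrary: Y rule: finite_induct)
  case empty
  then have "Y = {}" by (simp add: mset_set_empty_iff)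
  then show ?case by (simp add: bij_betw_def)
next
  case (insert x X)
  have eq: "add_mset (f x) (image_mset f (mset_set X)) = image_mset g (mset_set Y)"
    using insert.prems(2) insert.hyps by simp
  then have "f x \<in># image_mset g (mset_set Y)" by (metis union_single_eq_member)
  then obtain y where y: "y \<in> Y" "g y = f x" using insert.prems(1) by auto
  have "mset_set Y = add_mset y (mset_set (Y - {y}))"
    using y(1) insert.prems(1) by (simp add: mset_set.remove)
  then have "image_mset f (mset_set X) = image_mset g (mset_set (Y - {y}))"
    using eq y(2) by simp
  then obtain h where h: "bij_betw h X (Y - {y})" "\<forall>x\<in>X. g (h x) = f x"
    using insert.IH[of "Y - {y}"] insert.prems(1) by blast
  let ?h = "h(x := y)"
  have "bij_betw ?h X (Y - {y})"
    using h(1) insert.hyps(2) by (subst bij_betw_cong[of X ?h h]) auto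
  then have "bij_betw ?h (X \<union> {x}) ((Y - {y}) \<union> {?h x})"
    using insert.hyps(2) by (intro notIn_Un_bij_betw) auto
  moreover have "X \<union> {x} = insert x X" "(Y - {y}) \<union> {?h x} = Y" using y(1) by auto
  ultimately have "bij_betw ?h (insert x X) Y" by simp
  moreover have "\<forall>z\<in>insert x X. g (?h z) = f z" using h(2) y(2) insert.hyps(2) by auto
  ultimately show ?case by blast
qed

text \<open>Classes of equal size are matched by a bijection \<open>g\<close> of the quotients, a
  bijection \<open>k X\<close> is chosen between each class and its partner, and \<open>h\<close>
  glues these together.\<close>

lemma equiv_same_class_sizes_ex_bij:
  assumes E: "equiv A E" "finite A" and F: "equiv B F" "finite B"
    and sizes: "image_mset card (mset_set (A // E)) = image_mset card (mset_set (B // F))"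
  shows "\<exists>h. bij_betw h A B \<and> (\<forall>x\<in>A. \<forall>y\<in>A. (x, y) \<in> E \<longleftrightarrow> (h x, h y) \<in> F)"
proof -
  have fin: "finite (A // E)" "finite (B // F)"
    using E F by (simp_all add: finite_quotient equiv_type)
  then obtain g where g: "bij_betw g (A // E) (B // F)" "\<And>X. X \<in> A // E \<Longrightarrow> card (g X) = card X"
    using image_mset_eq_ex_bij[OF fin sizes] by blast
  have gX: "g X \<in> B // F" if "X \<in> A // E" for X using g(1) that by (auto simp: bij_betw_def)
  have "\<exists>k. bij_betw k X (g X)" if X: "X \<in> A // E" for X
  proof (rule finite_same_card_bij)
    show "finite X" using X E(2) by (meson E(1) equiv_type finite_equiv_class)
    show "finite (g X)" using gX[OF X] F(2) by (meson F(1) equiv_type finite_equiv_class)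
    show "card X = card (g X)" using g(2)[OF X] by simp
  qed
  then obtain k where k: "\<And>X. X \<in> A // E \<Longrightarrow> bij_betw (k X) X (g X)" by metis
  define h where "h x = k (E `` {x}) x" for x
  have cl: "E `` {x} \<in> A // E" "x \<in> E `` {x}" if "x \<in> A" for x
    by (rule quotientI[OF that], rule equiv_class_self[OF E(1) that])
  have hx: "h x \<in> g (E `` {x})" if "x \<in> A" for x
    unfolding h_def using bij_betwE[OF k[OF cl(1)[OF that]]] cl(2)[OF that] by blast
  have same: "E `` {x} = E `` {y}" if "x \<in> A" "y \<in> A" "(h x, h y) \<in> F" for x y
  proof -
    have "g (E `` {x}) = g (E `` {y})"
      using quotient_eqI[OF F(1) gX[OF cl(1)[OF that(1)]] gX[OF cl(1)[OF that(2)]] hx[OF that(1)] hx[OF that(2)] that(3)] .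
    then show ?thesis using g(1) cl(1) that(1,2) by (auto simp: bij_betw_def inj_on_def)
  qed
  have hB: "h x \<in> B" if "x \<in> A" for x
    using hx[OF that] gX[OF cl(1)[OF that]] Union_quotient[OF F(1)] by blast
  have "bij_betw h A B"
  proof (rule bij_betw_imageI)
    show "inj_on h A"
    proof (rule inj_onI)
      fix x y assume xy: "x \<in> A" "y \<in> A" "h x = h y"
      have "(h x, h y) \<in> F" using xy(3) hB[OF xy(1)] F(1) by (metis equivE refl_onD)
      from same[OF xy(1,2) this] have eq: "E `` {x} = E `` {y}" .
      have "inj_on (k (E `` {x})) (E `` {x})" using k[OF cl(1)[OF xy(1)]] by (rule bij_betw_imp_inj_on)
      moreover have "k (E `` {x}) x = k (E `` {x}) y" using xy(3) unfolding h_def eq .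
      ultimately show "x = y" using cl(2)[OF xy(1)] cl(2)[OF xy(2)] unfolding eq by (meson inj_onD)
    qed
    show "h ` A = B"
    proof (intro equalityI subsetI)
      fix b assume b: "b \<in> B"
      have "F `` {b} \<in> g ` (A // E)" using quotientI[OF b] g(1) by (simp add: bij_betw_def)
      then obtain X where X: "X \<in> A // E" "b \<in> g X"
        using equiv_class_self[OF F(1) b] by (elim imageE) simp
      then obtain a where a: "a \<in> X" "b = k X a" using k[OF X(1)] by (auto simp: bij_betw_def)
      have aA: "a \<in> A" using a(1) X(1) Union_quotient[OF E(1)] by blast
      have "X = E `` {a}"
        using X(1) a(1) by (elim quotientE) (simp add: equiv_class_eq[OF E(1)])
      then have "b = h a" using a(2) by (simp add: h_def)
      then show "b \<in> h ` A" using aA by blast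
    qed (use hB in auto)
  qed
  moreover have "(x, y) \<in> E \<longleftrightarrow> (h x, h y) \<in> F" if "x \<in> A" "y \<in> A" for x y
  proof
    assume "(x, y) \<in> E"
    then have "E `` {x} = E `` {y}" by (rule equiv_class_eq[OF E(1)])
    then have "h x \<in> g (E `` {x})" "h y \<in> g (E `` {x})"
      using hx[OF that(1)] hx[OF that(2)] by simp_all
    then show "(h x, h y) \<in> F" using gX[OF cl(1)[OF that(1)]] F(1) by (meson quotient_eq_iff)
  next
    assume "(h x, h y) \<in> F"
    from same[OF that this] show "(x, y) \<in> E" using that E(1) by (meson eq_equiv_class)
  qed
  ultimately show ?thesis by blast
qed

lemma sum_class_sizes:
  assumes "equiv A E" "finite A"
  shows "\<Sum>\<^sub># (image_mset card (mset_set (A // E))) = card A"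
proof -
  have "\<Sum>\<^sub># (image_mset card (mset_set (A // E))) = (\<Sum>X\<in>A // E. card X)"
    by (simp add: sum_unfold_sum_mset)
  also have "\<dots> = card (\<Union>(A // E))"
  proof (rule card_Union_disjoint[symmetric])
    show "pairwise disjnt (A // E)"
      using quotient_disj[OF assms(1)] by (fastforce simp: pairwise_def disjnt_def)
    show "finite X" if "X \<in> A // E" for X
      using that assms by (meson equiv_type finite_equiv_class)
  qed
  finally show ?thesis by (simp add: Union_quotient[OF assms(1)])
qed

section \<open>Transmittable algebras\<close>

text \<open>An existential quantifier cannot range over index types. Matrices are used as indices
  because the minimal projections serve as their own labels.\<close>

definition has_block_sizes :: "nat \<Rightarrow> complex mat set \<Rightarrow> nat multiset \<Rightarrow> bool" where
  "has_block_sizes N S M \<longleftrightarrow> (\<exists>(R :: complex mat set) E e. matrix_units N R E e \<and>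
     S = range (unit_combination N E e) \<and> M = image_mset card (mset_set (R // E)))"

text \<open>The sizes of the classes add up to \<open>card R\<close>, which orthogonality bounds by
  \<open>N\<close> and which is positive because an empty family would make the unit zero.\<close>

lemma (in matrix_star_algebra) ex_block_sizes:
  assumes nz: "S \<noteq> {0\<^sub>m N N}"
    and P: "P \<in> S" "\<And>x. x \<in> S \<Longrightarrow> P * x = x" "\<And>x. x \<in> S \<Longrightarrow> x * P = x"
  shows "\<exists>M. has_block_sizes N S M \<and> 0 \<notin># M \<and> \<Sum>\<^sub># M \<in> {1..N}"
proof -
  obtain R where R: "orthogonal_minimal_family N S R" "big_sum_mat N (\<lambda>p. p) R = P"
    using ex_complete_family[OF P] by blast
  interpret complete_minimal_family N S R
    by unfold_locales (simp_all add: R P)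
  let ?M = "image_mset card (mset_set (R // linked))"
  have sizes: "has_block_sizes N S ?M"
    unfolding has_block_sizes_def using matrix_units_linked range_unit_combination by blast
  have fin: "finite (R // linked)" using finite_family equiv_linked by (simp add: finite_quotient equiv_type)
  have "0 \<notin># ?M"
  proof
    assume "0 \<in># ?M"
    then obtain X where X: "X \<in> R // linked" "card X = 0" using fin by auto
    moreover have "finite X" by (rule finite_equiv_class[OF finite_family equiv_type[OF equiv_linked] X(1)])
    ultimately show False using in_quotient_imp_non_empty[OF equiv_linked X(1)] by simp
  qed
  moreover have "card R \<noteq> 0"
  proof
    assume "card R = 0"
    then have "P = 0\<^sub>m N N" using R(2) finite_family by simp
    then have "x = 0\<^sub>m N N" if "x \<in> S" for x
      using P(2)[OF that] left_mult_zero_mat[OF mem_carrier[OF that]] by simp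
    then show False using nz mem_zero by blast
  qed
  then have "\<Sum>\<^sub># ?M \<in> {1..N}"
    unfolding sum_class_sizes[OF equiv_linked finite_family]
    using card_orthogonal_minimal_family_le[OF R(1)] by simp
  ultimately show ?thesis using sizes by blast
qed

lemma same_block_sizes_star_isomorphic:
  assumes "has_block_sizes N S M" "has_block_sizes N T M"
  shows "star_isomorphic (mat_star_algebra N\<lparr>carrier := S\<rparr>) (mat_star_algebra N\<lparr>carrier := T\<rparr>)"
proof -
  obtain I :: "complex mat set" and E e where S: "matrix_units N I E e"
    "S = range (unit_combination N E e)" "M = image_mset card (mset_set (I // E))"
    using assms(1) unfolding has_block_sizes_def by blast
  obtain J :: "complex mat set" and F f where T: "matrix_units N J F f"
    "T = range (unit_combination N F f)" "M = image_mset card (mset_set (J // F))"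
    using assms(2) unfolding has_block_sizes_def by blast
  note DS = matrix_unitsD[OF S(1)] and DT = matrix_unitsD[OF T(1)]
  obtain h where h: "bij_betw h I J" "\<And>x y. x \<in> I \<Longrightarrow> y \<in> I \<Longrightarrow> (x, y) \<in> E \<longleftrightarrow> (h x, h y) \<in> F"
    using equiv_same_class_sizes_ex_bij[OF DS(2,1) DT(2,1)] S(3) T(3) by metis
  have re: "matrix_units N I E (\<lambda>a. f (map_prod h h a))"
    "range (unit_combination N E (\<lambda>a. f (map_prod h h a))) = range (unit_combination N F f)"
    by (rule matrix_units_reindex[OF T(1) DS(2) h(1)], rule h(2), assumption+)+
  show ?thesis
    using star_isomorphic_range_unit_combination[OF S(1) re(1)] unfolding re(2) S(2) T(2) .
qed

lemma star_isomorphic_trans: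
  assumes "star_isomorphic A B" "star_isomorphic B C"
  shows "star_isomorphic A C"
proof -
  obtain \<pi> where \<pi>: "star_hom A B \<pi>" "bij_betw \<pi> (carrier A) (carrier B)"
    using assms(1) unfolding star_isomorphic_def by blast
  obtain \<rho> where \<rho>: "star_hom B C \<rho>" "bij_betw \<rho> (carrier B) (carrier C)"
    using assms(2) unfolding star_isomorphic_def by blast
  have "star_hom A C (\<rho> \<circ> \<pi>)" using \<pi>(1) \<rho>(1) unfolding star_hom_def by simp
  then show ?thesis unfolding star_isomorphic_def using bij_betw_trans[OF \<pi>(2) \<rho>(2)] by blast
qed

text \<open>That the inverse map respects the operations rests on \<open>A\<close> being closed
  under them; this is where the algebra structure enters.\<close>

lemma (in fd_cstar_algebra) star_isomorphic_sym:
  assumes "star_isomorphic A B"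
  shows "star_isomorphic B A"
proof -
  obtain \<pi> where hom: "star_hom A B \<pi>" and bij: "bij_betw \<pi> (carrier A) (carrier B)"
    using assms unfolding star_isomorphic_def by blast
  define \<rho> where "\<rho> = the_inv_into (carrier A) \<pi>"
  have inj: "inj_on \<pi> (carrier A)" using bij by (rule bij_betw_imp_inj_on)
  have \<rho>\<pi>: "\<rho> (\<pi> x) = x" if "x \<in> carrier A" for x
    unfolding \<rho>_def by (rule the_inv_into_f_f[OF inj that])
  have mem: "\<exists>x\<in>carrier A. y = \<pi> x" if "y \<in> carrier B" for y
    using that bij by (auto simp: bij_betw_def)
  have smult: "a \<odot>\<^bsub>A\<^esub> x \<in> carrier A" if "x \<in> carrier A" for a x
    using smult_closed[OF _ that, of a] by (simp add: class_ring_simps)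
  note h = hom[unfolded star_hom_def]
  have add: "\<pi> x \<oplus>\<^bsub>B\<^esub> \<pi> y = \<pi> (x \<oplus>\<^bsub>A\<^esub> y)" if "x \<in> carrier A" "y \<in> carrier A" for x y
    using h that by simp
  have mult: "\<pi> x \<otimes>\<^bsub>B\<^esub> \<pi> y = \<pi> (x \<otimes>\<^bsub>A\<^esub> y)" if "x \<in> carrier A" "y \<in> carrier A" for x y
    using h that by simp
  have sm: "a \<odot>\<^bsub>B\<^esub> \<pi> x = \<pi> (a \<odot>\<^bsub>A\<^esub> x)" and st: "star B (\<pi> x) = \<pi> (star A x)"
    if "x \<in> carrier A" for a x
    using h that by simp_all
  have "star_hom B A \<rho>"
    unfolding star_hom_def
  proof (intro conjI ballI allI)
    fix y assume "y \<in> carrier B"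
    then obtain x where x: "x \<in> carrier A" "y = \<pi> x" using mem by blast
    show "\<rho> y \<in> carrier A" using x by (simp add: \<rho>\<pi>)
    show "\<rho> (a \<odot>\<^bsub>B\<^esub> y) = a \<odot>\<^bsub>A\<^esub> \<rho> y" for a
      using x smult[OF x(1)] by (simp add: \<rho>\<pi> sm)
    show "\<rho> (star B y) = star A (\<rho> y)" using x star_closed[OF x(1)] by (simp add: \<rho>\<pi> st)
    fix z assume "z \<in> carrier B"
    then obtain w where w: "w \<in> carrier A" "z = \<pi> w" using mem by blast
    show "\<rho> (y \<oplus>\<^bsub>B\<^esub> z) = \<rho> y \<oplus>\<^bsub>A\<^esub> \<rho> z" using x w by (simp add: \<rho>\<pi> add)
    show "\<rho> (y \<otimes>\<^bsub>B\<^esub> z) = \<rho> y \<otimes>\<^bsub>A\<^esub> \<rho> z"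
      using x w mult_closed[OF x(1) w(1)] by (simp add: \<rho>\<pi> mult)
  qed
  then show ?thesis
    unfolding star_isomorphic_def \<rho>_def using bij_betw_the_inv_into[OF bij] by blast
qed

lemma transmittable_ex_block_sizes:
  assumes "transmittable D K \<Phi> A"
  shows "\<exists>S M. star_isomorphic A (mat_star_algebra D\<lparr>carrier := S\<rparr>) \<and> has_block_sizes D S M \<and>
    0 \<notin># M \<and> \<Sum>\<^sub># M \<in> {1..D}"
proof -
  obtain \<pi> where hom: "star_hom A (mat_star_algebra D) \<pi>" and inj: "inj_on \<pi> (carrier A)"
    and corr: "correctable D K \<Phi> (\<pi> ` carrier A)"
    using assms unfolding transmittable_def by blast
  let ?S = "\<pi> ` carrier A"
  have sub: "star_subalgebra ?S (mat_star_algebra D)" and nz: "?S \<noteq> {0\<^sub>m D D}"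
    and unit: "\<exists>P. P \<in> ?S \<and> (\<forall>X\<in>?S. P * X = X \<and> X * P = X)"
    using corr unfolding correctable_def by blast+
  obtain P where P: "P \<in> ?S" "\<And>x. x \<in> ?S \<Longrightarrow> P * x = x" "\<And>x. x \<in> ?S \<Longrightarrow> x * P = x"
    using unit by blast
  interpret matrix_star_algebra D ?S using sub by unfold_locales
  have "star_hom A (mat_star_algebra D\<lparr>carrier := ?S\<rparr>) \<pi>"
    using hom by (simp add: star_hom_def mat_star_algebra_def)
  moreover have "bij_betw \<pi> (carrier A) (carrier (mat_star_algebra D\<lparr>carrier := ?S\<rparr>))"
    using inj by (simp add: bij_betw_def)
  ultimately have "star_isomorphic A (mat_star_algebra D\<lparr>carrier := ?S\<rparr>)"
    unfolding star_isomorphic_def by blast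
  then show ?thesis using ex_block_sizes[OF nz P] by blast
qed

text \<open>Each algebra is assigned one partition \<open>\<tau> A\<close>. Algebras with the same
  partition are isomorphic through the subalgebras that realise it, so an isomorphism class can be
  recovered from a partition.\<close>

lemma max_transmittable_classes_card:
  "finite (max_transmittable_classes D K \<Phi>) \<and>
   card (max_transmittable_classes D K \<Phi>) \<le> (\<Sum>r = 1..D. num_partitions r)"
proof -
  let ?X = "max_transmittable D K \<Phi>"
  let ?r = "{(A, B). A \<in> ?X \<and> B \<in> ?X \<and> star_isomorphic A B}"
  let ?P = "{M :: nat multiset. 0 \<notin># M \<and> \<Sum>\<^sub># M \<in> {1..D}}"
  have finP: "finite ?P"
    by (rule finite_subset[OF _ finite_partitions_upto[of D]]) (auto simp: partitions_upto_def)
  have trm: "transmittable D K \<Phi> A" if "A \<in> ?X" for A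
    using that by (simp add: max_transmittable_def transmittable_algebras_def)
  have "\<forall>A\<in>?X. \<exists>M. M \<in> ?P \<and> (\<exists>S. star_isomorphic A (mat_star_algebra D\<lparr>carrier := S\<rparr>) \<and> has_block_sizes D S M)"
  proof
    fix A assume "A \<in> ?X"
    from transmittable_ex_block_sizes[OF trm[OF this]]
    show "\<exists>M. M \<in> ?P \<and> (\<exists>S. star_isomorphic A (mat_star_algebra D\<lparr>carrier := S\<rparr>) \<and> has_block_sizes D S M)"
      by (elim exE conjE) (intro exI conjI CollectI; assumption)
  qed
  from bchoice[OF this] obtain \<tau> where \<tau>: "\<And>A. A \<in> ?X \<Longrightarrow> \<tau> A \<in> ?P"
    "\<And>A. A \<in> ?X \<Longrightarrow> \<exists>S. star_isomorphic A (mat_star_algebra D\<lparr>carrier := S\<rparr>) \<and> has_block_sizes D S (\<tau> A)"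
    by auto
  have sym: "star_isomorphic B A" if "star_isomorphic A B" "A \<in> ?X" for A B
  proof -
    interpret fd_cstar_algebra A using trm[OF that(2)] by (simp add: transmittable_def)
    show ?thesis using that(1) by (rule star_isomorphic_sym)
  qed
  have iso: "star_isomorphic A B" if AB: "A \<in> ?X" "B \<in> ?X" "\<tau> A = \<tau> B" for A B
  proof -
    obtain S where S: "star_isomorphic A (mat_star_algebra D\<lparr>carrier := S\<rparr>)" "has_block_sizes D S (\<tau> A)"
      using \<tau>(2)[OF AB(1)] by blast
    obtain T where T: "star_isomorphic B (mat_star_algebra D\<lparr>carrier := T\<rparr>)" "has_block_sizes D T (\<tau> A)"
      using \<tau>(2)[OF AB(2)] AB(3) by auto
    interpret B: fd_cstar_algebra B using trm[OF AB(2)] by (simp add: transmittable_def)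
    show ?thesis
      using star_isomorphic_trans[OF star_isomorphic_trans[OF S(1) same_block_sizes_star_isomorphic[OF S(2) T(2)]]
        B.star_isomorphic_sym[OF T(1)]] .
  qed
  have cls: "?r `` {A} = ?r `` {B}" if AB: "A \<in> ?X" "B \<in> ?X" "\<tau> A = \<tau> B" for A B
  proof -
    have "star_isomorphic A B" "star_isomorphic B A" using iso AB by simp_all
    then have eq: "star_isomorphic A C \<longleftrightarrow> star_isomorphic B C" for C
      using star_isomorphic_trans[of A B C] star_isomorphic_trans[of B A C] by blast
    show ?thesis
    proof (rule Set.set_eqI)
      fix C
      show "C \<in> ?r `` {A} \<longleftrightarrow> C \<in> ?r `` {B}"
        unfolding Image_singleton_iff mem_Collect_eq prod.case eq[of C] using AB(1,2) by simp
    qed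
  qed
  \<comment> \<open>For a partition attained by no algebra the value is arbitrary, which is harmless
    since only a covering of the classes is claimed.\<close>
  define G where "G M = ?r `` {SOME A. A \<in> ?X \<and> \<tau> A = M}" for M
  have sub: "max_transmittable_classes D K \<Phi> \<subseteq> G ` ?P"
  proof
    fix C assume "C \<in> max_transmittable_classes D K \<Phi>"
    then obtain A where A: "A \<in> ?X" "C = ?r `` {A}"
      unfolding max_transmittable_classes_def by (elim quotientE)
    have "(SOME B. B \<in> ?X \<and> \<tau> B = \<tau> A) \<in> ?X \<and> \<tau> (SOME B. B \<in> ?X \<and> \<tau> B = \<tau> A) = \<tau> A"
      by (rule someI[of "\<lambda>B. B \<in> ?X \<and> \<tau> B = \<tau> A" A]) (simp add: A(1))
    then have "G (\<tau> A) = C"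
      unfolding G_def A(2) by (intro cls) (simp_all add: A(1))
    then show "C \<in> G ` ?P" using \<tau>(1)[OF A(1)] by blast
  qed
  have "finite (max_transmittable_classes D K \<Phi>)"
    using sub finP by (rule finite_subset[OF _ finite_imageI])
  moreover have "card (max_transmittable_classes D K \<Phi>) \<le> card ?P"
    using surj_card_le[OF finP sub] .
  ultimately show ?thesis unfolding sum_num_partitions by simp
qed

section \<open>Bounds on the width\<close>

lemma width_le_sum_num_partitions:
  "width d k \<Phi> n \<le> (\<Sum>r = 1..d ^ n. num_partitions r)"
  unfolding width_def using max_transmittable_classes_card by blast

lemma width_le_power:
  "real (width d k \<Phi> n) \<le> 2 ^ (d ^ n) - 1"
proof -
  have "width d k \<Phi> n \<le> 2 ^ (d ^ n) - 1"
    using width_le_sum_num_partitions[of d k \<Phi> n] sum_num_partitions_le_power[of "d ^ n"] by linarith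
  then have "real (width d k \<Phi> n) \<le> real (2 ^ (d ^ n) - 1)" by (rule of_nat_mono)
  then show ?thesis by (simp add: of_nat_diff)
qed

text \<open>Needed for d = 1, where the bound is constant in n. Numerically the exponent is at least
  12/5, exp (6/5) is at least 14/5, and 196/25 exceeds 36/5, which is at least 4 sqrt 3.\<close>

lemma partition_bound_at_one_ge_one: "1 \<le> exp (pi * sqrt (2 / 3)) / (4 * sqrt 3)"
proof -
  have "4 / 5 \<le> sqrt (2 / 3)" by (rule real_le_rsqrt) (simp add: power2_eq_square)
  then have "3 * (4 / 5) \<le> pi * sqrt (2 / 3)" using pi_gt3 by (intro mult_mono) auto
  then have "exp (2 * (6 / 5)) \<le> exp (pi * sqrt (2 / 3))" by simp
  moreover have "(14 / 5)\<^sup>2 \<le> exp (6 / 5 :: real) ^ 2"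
    using exp_lower_Taylor_quadratic[of "6 / 5"] by (intro power_mono) (auto simp: power2_eq_square)
  moreover have "exp (2 * (6 / 5)) = exp (6 / 5 :: real) ^ 2" by (rule exp_double)
  moreover have "(14 / 5 :: real)\<^sup>2 = 196 / 25" by (simp add: power2_eq_square)
  ultimately have "196 / 25 \<le> exp (pi * sqrt (2 / 3))" by linarith
  moreover have "sqrt 3 \<le> 9 / 5" by (rule real_le_lsqrt) (simp_all add: power2_eq_square)
  ultimately have "4 * sqrt 3 \<le> exp (pi * sqrt (2 / 3))" by linarith
  then show ?thesis by (simp add: field_simps)
qed

text \<open>For d \<ge> 2 the estimate of the partition count is composed with the divergent
  sequence d^n. For d \<le> 1 that sequence does not diverge, but 2^(d^n) - 1 is 0 or 1 once n \<ge>
  1.\<close>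

lemma eventually_width_le:
  "eventually (\<lambda>n. real (width d k \<Phi> n) \<le>
     1 / (4 * sqrt 3) * exp (pi * sqrt (2 * real (d ^ n) / 3))) sequentially"
proof (cases "d \<le> 1")
  case True
  have "real (width d k \<Phi> n) \<le> 1 / (4 * sqrt 3) * exp (pi * sqrt (2 * real (d ^ n) / 3))" if "n \<ge> 1" for n
  proof (cases "d = 0")
    case True
    then show ?thesis using width_le_power[of d k \<Phi> n] that by (simp add: power_0_left)
  next
    case False
    then have "d = 1" using \<open>d \<le> 1\<close> by simp
    have "real (width d k \<Phi> n) \<le> 1" using width_le_power[of d k \<Phi> n] \<open>d = 1\<close> by simp
    also note partition_bound_at_one_ge_one
    finally show ?thesis using \<open>d = 1\<close> by simp
  qed
  then show ?thesis unfolding eventually_sequentially by blast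
next
  case False
  have "filterlim (\<lambda>n. d ^ n) at_top sequentially"
    using False by (intro filterlim_subseq strict_monoI_Suc) simp
  moreover have "eventually (\<lambda>N. card (partitions_upto N) \<le>
      1 / (4 * sqrt 3) * exp (pi * sqrt (2 * real N / 3))) sequentially"
    by (rule eventually_card_partitions_upto_le) simp
  ultimately have "eventually (\<lambda>n. card (partitions_upto (d ^ n)) \<le>
      1 / (4 * sqrt 3) * exp (pi * sqrt (2 * real (d ^ n) / 3))) sequentially"
    by (rule eventually_compose_filterlim[rotated])
  then show ?thesis
  proof eventually_elim
    case (elim n)
    have "width d k \<Phi> n \<le> card (partitions_upto (d ^ n))"
      using width_le_sum_num_partitions sum_num_partitions_le_card by (rule order.trans)
    then show ?case using elim by linarith
  qed
qed

theorem proposition5p4: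
  fixes d k :: nat and \<Phi> :: "complex mat \<Rightarrow> complex mat"
  assumes "quantum_channel d k \<Phi>"
  shows "(\<forall>n\<ge>1.
            finite (max_transmittable_classes (d ^ n) (k ^ n) (tensor_power d k \<Phi> n)) \<and>
            width d k \<Phi> n \<le> (\<Sum>r = 1..d ^ n. num_partitions r) \<and>
            (\<Sum>r = 1..d ^ n. num_partitions r) \<le> 2 ^ (d ^ n) - 1) \<and>
         (\<exists>\<epsilon> :: nat \<Rightarrow> real. \<epsilon> \<longlonglongrightarrow> 0 \<and>
            (\<forall>n\<ge>1. real (width d k \<Phi> n) \<le>
               (1 + \<epsilon> n) / (4 * sqrt 3) * exp (pi * sqrt (2 * real (d ^ n) / 3)))) \<and>
         (\<exists>c :: real. \<forall>n\<ge>1. real (width d k \<Phi> n) \<le> exp (exp (c * real n)))"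
proof (intro conjI)
  show "\<forall>n\<ge>1. finite (max_transmittable_classes (d ^ n) (k ^ n) (tensor_power d k \<Phi> n)) \<and>
      width d k \<Phi> n \<le> (\<Sum>r = 1..d ^ n. num_partitions r) \<and>
      (\<Sum>r = 1..d ^ n. num_partitions r) \<le> 2 ^ (d ^ n) - 1"
    using max_transmittable_classes_card width_le_sum_num_partitions sum_num_partitions_le_power by simp
  define B where "B n = exp (pi * sqrt (2 * real (d ^ n) / 3)) / (4 * sqrt 3)" for n
  \<comment> \<open>The relative excess over \<open>B\<close>, cut off at 0. The inequality then
    holds for every \<open>n\<close> by construction, and since the excess eventually disappears the
    sequence is eventually 0.\<close>
  define \<epsilon> where "\<epsilon> n = max 0 (real (width d k \<Phi> n) / B n - 1)" for n
  have B: "B n > 0" for n by (simp add: B_def)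
  have "eventually (\<lambda>n. \<epsilon> n = 0) sequentially"
    using eventually_width_le[of d k \<Phi>]
  proof eventually_elim
    case (elim n)
    then have "real (width d k \<Phi> n) \<le> B n" by (simp add: B_def)
    then show ?case using B[of n] by (simp add: \<epsilon>_def)
  qed
  then have "\<epsilon> \<longlonglongrightarrow> 0" by (rule tendsto_eventually)
  moreover have "real (width d k \<Phi> n) \<le> (1 + \<epsilon> n) / (4 * sqrt 3) * exp (pi * sqrt (2 * real (d ^ n) / 3))" for n
  proof -
    have "real (width d k \<Phi> n) / B n \<le> 1 + \<epsilon> n" by (simp add: \<epsilon>_def)
    then have "real (width d k \<Phi> n) \<le> (1 + \<epsilon> n) * B n" using B[of n] by (simp add: pos_divide_le_eq)
    then show ?thesis by (simp add: B_def)
  qed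
  ultimately show "\<exists>\<epsilon> :: nat \<Rightarrow> real. \<epsilon> \<longlonglongrightarrow> 0 \<and> (\<forall>n\<ge>1. real (width d k \<Phi> n) \<le>
      (1 + \<epsilon> n) / (4 * sqrt 3) * exp (pi * sqrt (2 * real (d ^ n) / 3)))"
    by blast
  \<comment> \<open>The choice c = d works because 2 \<le> exp 1 and d \<le> exp d; this form of the
    constant also covers d = 0, where a logarithm of d would not.\<close>
  have "real (width d k \<Phi> n) \<le> exp (exp (real d * real n))" for n
  proof -
    have d_le: "real d \<le> exp (real d)" using exp_ge_add_one_self[of "real d"] by linarith
    have "real (width d k \<Phi> n) \<le> 2 ^ (d ^ n)" using width_le_power[of d k \<Phi> n] by linarith
    also have "\<dots> \<le> exp 1 ^ (d ^ n)" using exp_ge_add_one_self[of 1] by (intro power_mono) auto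
    also have "\<dots> = exp (real d ^ n)" by (simp add: exp_of_nat_mult[symmetric])
    also have "\<dots> \<le> exp (exp (real d) ^ n)"
      using d_le by (simp add: power_mono)
    also have "exp (real d) ^ n = exp (real d * real n)"
      by (simp add: exp_of_nat_mult[symmetric] mult.commute)
    finally show ?thesis .
  qed
  then show "\<exists>c :: real. \<forall>n\<ge>1. real (width d k \<Phi> n) \<le> exp (exp (c * real n))" by blast
qed

end
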